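(* Let $n\ge 2$ be an integer and let $q\in\mathbb{C}$ with $q\ne 0$ and $q\ne -1$. Let $\rho: TW_n\to \mathrm{O}(\mathbf{E})$ be the reflection representation of the twin group, defined on generators by sending $t_i$ to $\overline{S}_i$ for all $i=1,\dots,n-1$. Assume that $[n]_q\ne 0$, that $[n-2]^!_q\ne 0$, and that $$q\ne \frac{-\lambda\pm\sqrt{-1-2\lambda}}{1+\lambda}$$ for any $\lambda\ne -1$ of the form $\lambda=\cos(2k\pi/m)$ with $k\in\mathbb{Z}$ and $m\in\mathbb{Z}_{\ge 1}$ (both choices of sign being excluded). Then the image $\rho(TW_n)$ is Zariski-dense in $\mathrm{O}(\mathbf{L})\times \mathrm{O}(\mathbf{F})$. Hence the image of the reduced reflection representation $TW_n\to \mathrm{O}(\mathbf{F})$ (the restriction of $\rho$ to $\mathbf{F}$) is Zariski-dense in $\mathrm{O}(\mathbf{F})$.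
   Context: For an integer $k\ge 0$, $[k]_q=1+q+\cdots+q^{k-1}$ (so $[0]_q=0$) and $[k]^!_q=[1]_q[2]_q\cdots[k]_q$ (so $[0]^!_q=1$). $\mathbf{E}$ is a complex vector space with basis $\mathbf{e}_1,\dots,\mathbf{e}_n$, equipped with the nondegenerate symmetric bilinear form $\langle \mathbf{e}_i,\mathbf{e}_j\rangle=\delta_{ij}q^{j-1}$, and $\mathrm{O}(\mathbf{E})$ is the group of linear operators on $\mathbf{E}$ preserving this form. Put $\boldsymbol{\ell}_0=\mathbf{e}_1+\cdots+\mathbf{e}_n$, $\mathbf{L}=\mathbb{C}\boldsymbol{\ell}_0$ and $\mathbf{F}=\bigoplus_{i=1}^{n-1}\mathbb{C}(q\mathbf{e}_i-\mathbf{e}_{i+1})=\mathbf{L}^\perp$. When $[n]_q\neq 0$ one has $\mathbf{E}=\mathbf{L}\oplus\mathbf{F}$ and the form is nondegenerate on each summand; $\mathrm{O}(\mathbf{L})$ and $\mathrm{O}(\mathbf{F})$ are the orthogonal groups of the restricted forms, and $\mathrm{O}(\mathbf{L})\times\mathrm{O}(\mathbf{F})$ is regarded as a subgroup of $\mathrm{O}(\mathbf{E})$. The twin group $TW_n$ is the group generated by $t_1,\dots,t_{n-1}$ subject to $t_i^2=1$ and $t_it_j=t_jt_i$ if $|i-j|>1$. For $q\neq 0,-1$ and $1\le i\le n-1$, the operator $\overline{S}_i\in \mathrm{O}(\mathbf{E})$ is $$\overline{S}_i\mathbf{e}_i=\tfrac{1}{1+q}\big((1-q)\mathbf{e}_i+2\mathbf{e}_{i+1}\big),\quad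 \overline{S}_i\mathbf{e}_{i+1}=\tfrac{1}{1+q}\big(2q\,\mathbf{e}_i-(1-q)\mathbf{e}_{i+1}\big),\quad \overline{S}_i\mathbf{e}_j=\mathbf{e}_j\ (j\ne i,i+1);$$ it is the orthogonal reflection sending $q\mathbf{e}_i-\mathbf{e}_{i+1}$ to its negative. Each $\overline{S}_i$ preserves $\mathbf{L}$ and $\mathbf{F}$, so $\rho(TW_n)\subset \mathrm{O}(\mathbf{L})\times\mathrm{O}(\mathbf{F})$.
   Formalization: The first density claim is false as printed: every S̄_i fixes ℓ_0, so the image acts trivially on L while −1 lies in O(L). It is replaced by density in the subgroup {1_L}×O(F) of O(L)×O(F); density of the reduced representation in O(F) is unchanged. *)

theory Defs
  imports
    "HOL-Library.Function_Algebras"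
    "HOL-Algebra.Bij"
    "HOL-Analysis.Abstract_Topology"
    Complex_Main
begin

section \<open>Groups given by generators and relations\<close>

text \<open>The letter \<open>(x, True)\<close> stands for the generator \<open>x\<close> and \<open>(x, False)\<close> for its formal
  inverse. A pair \<open>(r, s)\<close> in \<open>R\<close> is the relation \<open>r = s\<close>.\<close>

type_synonym 'a gword = "('a \<times> bool) list"

inductive pres_eq :: "'a set \<Rightarrow> ('a gword \<times> 'a gword) set \<Rightarrow> 'a gword \<Rightarrow> 'a gword \<Rightarrow> bool"
  for X :: "'a set" and R :: "('a gword \<times> 'a gword) set" where
  pres_refl: "w \<in> lists (X \<times> UNIV) \<Longrightarrow> pres_eq X R w w"
| pres_sym: "pres_eq X R v w \<Longrightarrow> pres_eq X R w v"
| pres_trans: "pres_eq X R u v \<Longrightarrow> pres_eq X R v w \<Longrightarrow> pres_eq X R u w"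
| pres_cancel: "u \<in> lists (X \<times> UNIV) \<Longrightarrow> v \<in> lists (X \<times> UNIV) \<Longrightarrow> x \<in> X \<Longrightarrow>
    pres_eq X R (u @ [(x, b), (x, \<not> b)] @ v) (u @ v)"
| pres_rel: "u \<in> lists (X \<times> UNIV) \<Longrightarrow> v \<in> lists (X \<times> UNIV) \<Longrightarrow>
    r \<in> lists (X \<times> UNIV) \<Longrightarrow> s \<in> lists (X \<times> UNIV) \<Longrightarrow> (r, s) \<in> R \<Longrightarrow>
    pres_eq X R (u @ r @ v) (u @ s @ v)"

definition pres_class :: "'a set \<Rightarrow> ('a gword \<times> 'a gword) set \<Rightarrow> 'a gword \<Rightarrow> 'a gword set" where
  "pres_class X R w = {v. pres_eq X R w v}"

definition presented_group :: "'a set \<Rightarrow> ('a gword \<times> 'a gword) set \<Rightarrow> 'a gword set monoid" where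
  "presented_group X R =
    \<lparr>carrier = pres_class X R ` lists (X \<times> UNIV),
     mult = (\<lambda>A B. \<Union>a\<in>A. \<Union>b\<in>B. pres_class X R (a @ b)),
     one = pres_class X R []\<rparr>"

definition TW_rels :: "nat \<Rightarrow> (nat gword \<times> nat gword) set" where
  "TW_rels n =
    {([(i, True), (i, True)], []) | i. i \<in> {1..n-1}} \<union>
    {([(i, True), (j, True)], [(j, True), (i, True)]) | i j.
       i \<in> {1..n-1} \<and> j \<in> {1..n-1} \<and> \<bar>int i - int j\<bar> > 1}"

definition TW :: "nat \<Rightarrow> nat gword set monoid" where
  "TW n = presented_group {1..n-1} (TW_rels n)"

definition tw_gen :: "nat \<Rightarrow> nat \<Rightarrow> nat gword set" where
  "tw_gen n i = pres_class {1..n-1} (TW_rels n) [(i, True)]"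

section \<open>The quadratic space and its subspaces\<close>

definition q_int :: "complex \<Rightarrow> nat \<Rightarrow> complex" where
  "q_int q k = (\<Sum>i<k. q ^ i)"

definition q_fact :: "complex \<Rightarrow> nat \<Rightarrow> complex" where
  "q_fact q k = (\<Prod>i\<in>{1..k}. q_int q i)"

type_synonym cvec = "nat \<Rightarrow> complex"

definition cscale :: "complex \<Rightarrow> cvec \<Rightarrow> cvec" (infixr \<open>*\<^sub>c\<close> 75) where
  "c *\<^sub>c x = (\<lambda>i. c * x i)"

global_interpretation cvec: vector_space cscale
  by standard (auto simp: cscale_def fun_eq_iff algebra_simps)

definition bas :: "nat \<Rightarrow> cvec" where
  "bas j = (\<lambda>i. if i = j then 1 else 0)"

definition spE :: "nat \<Rightarrow> cvec set" where
  "spE n = cvec.span (bas ` {1..n})"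

definition bform :: "nat \<Rightarrow> complex \<Rightarrow> cvec \<Rightarrow> cvec \<Rightarrow> complex" where
  "bform n q x y = (\<Sum>j\<in>{1..n}. q ^ (j - 1) * x j * y j)"

definition ell0 :: "nat \<Rightarrow> cvec" where
  "ell0 n = (\<Sum>j\<in>{1..n}. bas j)"

definition spL :: "nat \<Rightarrow> cvec set" where
  "spL n = cvec.span {ell0 n}"

definition spF :: "nat \<Rightarrow> complex \<Rightarrow> cvec set" where
  "spF n q = cvec.span ((\<lambda>i. q *\<^sub>c bas i - bas (i + 1)) ` {1..n-1})"

section \<open>Linear operators, orthogonal groups, Zariski topology\<close>

text \<open>An operator on a subspace \<open>V\<close> is represented by a function that is \<open>undefined\<close>
  outside \<open>V\<close>, as in \<^const>\<open>BijGroup\<close>.\<close>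

definition lin_ops :: "cvec set \<Rightarrow> (cvec \<Rightarrow> cvec) set" where
  "lin_ops V = {T \<in> V \<rightarrow>\<^sub>E V. (\<forall>x\<in>V. \<forall>y\<in>V. T (x + y) = T x + T y) \<and>
     (\<forall>c. \<forall>x\<in>V. T (c *\<^sub>c x) = c *\<^sub>c T x)}"

definition orth_group :: "nat \<Rightarrow> complex \<Rightarrow> cvec set \<Rightarrow> (cvec \<Rightarrow> cvec) monoid" where
  "orth_group n q V = (BijGroup V)\<lparr>carrier :=
     {T \<in> lin_ops V \<inter> Bij V. \<forall>x\<in>V. \<forall>y\<in>V. bform n q (T x) (T y) = bform n q x y}\<rparr>"

definition orth_prod :: "nat \<Rightarrow> complex \<Rightarrow> (cvec \<Rightarrow> cvec) set" where
  "orth_prod n q = {T \<in> carrier (orth_group n q (spE n)).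
     restrict T (spL n) \<in> carrier (orth_group n q (spL n)) \<and>
     restrict T (spF n q) \<in> carrier (orth_group n q (spF n q))}"

text \<open>Polynomial functions on \<open>End V\<close>. For \<open>V\<close> inside some \<^term>\<open>spE n\<close> the coordinates
  \<open>x \<mapsto> x i\<close> span the dual of \<open>V\<close>, so the functions \<open>T \<mapsto> T v i\<close> with \<open>v \<in> V\<close> span the
  linear functionals on \<open>End V\<close>.\<close>

inductive_set poly_funs :: "cvec set \<Rightarrow> ((cvec \<Rightarrow> cvec) \<Rightarrow> complex) set" for V :: "cvec set" where
  const: "(\<lambda>T. c) \<in> poly_funs V"
| coord: "v \<in> V \<Longrightarrow> (\<lambda>T. T v i) \<in> poly_funs V"
| add: "f \<in> poly_funs V \<Longrightarrow> g \<in> poly_funs V \<Longrightarrow> (\<lambda>T. f T + g T) \<in> poly_funs V"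
| mult: "f \<in> poly_funs V \<Longrightarrow> g \<in> poly_funs V \<Longrightarrow> (\<lambda>T. f T * g T) \<in> poly_funs V"

text \<open>The closed sets are the common zero loci of families \<open>P\<close> of polynomial functions
  (see \<open>closedin_zariski\<close>).\<close>

definition zariski :: "cvec set \<Rightarrow> (cvec \<Rightarrow> cvec) topology" where
  "zariski V = topology (\<lambda>U. \<exists>P \<subseteq> poly_funs V. U = lin_ops V - {T \<in> lin_ops V. \<forall>p\<in>P. p T = 0})"

lemma openin_zariski:
  "openin (zariski V) U \<longleftrightarrow>
     (\<exists>P \<subseteq> poly_funs V. U = lin_ops V - {T \<in> lin_ops V. \<forall>p\<in>P. p T = 0})"
proof -
  let ?Z = "\<lambda>P. lin_ops V - {T \<in> lin_ops V. \<forall>p\<in>P. p T = 0}"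
  have "istopology (\<lambda>U. \<exists>P \<subseteq> poly_funs V. U = ?Z P)"
    unfolding istopology_def
  proof (intro conjI allI impI)
    fix S T assume "\<exists>P \<subseteq> poly_funs V. S = ?Z P" "\<exists>P \<subseteq> poly_funs V. T = ?Z P"
    then obtain P Q where PQ: "P \<subseteq> poly_funs V" "S = ?Z P" "Q \<subseteq> poly_funs V" "T = ?Z Q"
      by blast
    let ?W = "{(\<lambda>T. f T * g T) | f g. f \<in> P \<and> g \<in> Q}"
    have "?W \<subseteq> poly_funs V"
      using PQ by (auto intro: poly_funs.mult)
    moreover have "S \<inter> T = ?Z ?W"
    proof (intro equalityI subsetI)
      fix x assume "x \<in> S \<inter> T"
      then obtain f g where "x \<in> lin_ops V" "f \<in> P" "g \<in> Q" "f x \<noteq> 0" "g x \<noteq> 0"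
        unfolding PQ by blast
      moreover from this have "(\<lambda>T. f T * g T) \<in> ?W"
        by blast
      ultimately show "x \<in> ?Z ?W"
        by force
    next
      fix x assume "x \<in> ?Z ?W"
      then obtain f g where "x \<in> lin_ops V" "f \<in> P" "g \<in> Q" "f x * g x \<noteq> 0"
        by blast
      then show "x \<in> S \<inter> T"
        unfolding PQ by auto
    qed
    ultimately show "\<exists>P \<subseteq> poly_funs V. S \<inter> T = ?Z P"
      by blast
  next
    fix K assume K: "\<forall>S\<in>K. \<exists>P \<subseteq> poly_funs V. S = ?Z P"
    let ?W = "\<Union>{P. P \<subseteq> poly_funs V \<and> ?Z P \<in> K}"
    have "\<Union>K = ?Z ?W"
    proof (intro equalityI subsetI)
      fix x assume "x \<in> \<Union>K"
      then obtain S where S: "x \<in> S" "S \<in> K" by (rule UnionE)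
      with K obtain P where P: "P \<subseteq> poly_funs V" "S = ?Z P" by (meson bspec)
      with S have "P \<subseteq> ?W" by blast
      moreover have "x \<in> ?Z P" using S P by simp
      ultimately show "x \<in> ?Z ?W" by blast
    next
      fix x assume "x \<in> ?Z ?W"
      then have "x \<in> lin_ops V" "\<exists>p\<in>?W. p x \<noteq> 0" by auto
      then obtain p P where "P \<subseteq> poly_funs V" "p x \<noteq> 0" "p \<in> P" "?Z P \<in> K"
        by blast
      moreover from this \<open>x \<in> lin_ops V\<close> have "x \<in> ?Z P" by auto
      ultimately show "x \<in> \<Union>K" by blast
    qed
    moreover have "?W \<subseteq> poly_funs V" by blast
    ultimately show "\<exists>P \<subseteq> poly_funs V. \<Union>K = ?Z P" by blast
  qed
  then show ?thesis
    by (simp add: zariski_def topology_inverse')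
qed

lemma topspace_zariski [simp]: "topspace (zariski V) = lin_ops V"
proof -
  have "openin (zariski V) (lin_ops V)"
    unfolding openin_zariski
    by (rule exI[of _ "{\<lambda>T. 1}"]) (auto intro: poly_funs.const)
  moreover have "U \<subseteq> lin_ops V" if "openin (zariski V) U" for U
    using that unfolding openin_zariski by blast
  ultimately show ?thesis
    by (meson openin_subset openin_topspace subset_antisym)
qed

lemma closedin_zariski:
  "closedin (zariski V) C \<longleftrightarrow> (\<exists>P \<subseteq> poly_funs V. C = {T \<in> lin_ops V. \<forall>p\<in>P. p T = 0})"
proof
  assume "closedin (zariski V) C"
  then obtain P where "C \<subseteq> lin_ops V" "P \<subseteq> poly_funs V"
    "lin_ops V - C = lin_ops V - {T \<in> lin_ops V. \<forall>p\<in>P. p T = 0}"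
    unfolding closedin_def topspace_zariski openin_zariski by auto
  then have "C = {T \<in> lin_ops V. \<forall>p\<in>P. p T = 0}"
    by (metis (no_types, lifting) Diff_Diff_Int inf.absorb2 mem_Collect_eq subsetI)
  with \<open>P \<subseteq> poly_funs V\<close> show "\<exists>P \<subseteq> poly_funs V. C = {T \<in> lin_ops V. \<forall>p\<in>P. p T = 0}"
    by blast
next
  assume "\<exists>P \<subseteq> poly_funs V. C = {T \<in> lin_ops V. \<forall>p\<in>P. p T = 0}"
  then obtain P where "P \<subseteq> poly_funs V" "C = {T \<in> lin_ops V. \<forall>p\<in>P. p T = 0}"
    by auto
  then show "closedin (zariski V) C"
    unfolding closedin_def topspace_zariski openin_zariski
    by (intro conjI exI[of _ P]) auto
qed

definition zariski_dense :: "cvec set \<Rightarrow> (cvec \<Rightarrow> cvec) set \<Rightarrow> (cvec \<Rightarrow> cvec) set \<Rightarrow> bool" where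
  "zariski_dense V X G \<longleftrightarrow> X \<subseteq> G \<and> (subtopology (zariski V) G) closure_of X = G"

section \<open>The reflections\<close>

definition Sbar_bas :: "complex \<Rightarrow> nat \<Rightarrow> nat \<Rightarrow> cvec" where
  "Sbar_bas q i j =
    (if j = i then (1 / (1 + q)) *\<^sub>c ((1 - q) *\<^sub>c bas i + 2 *\<^sub>c bas (i + 1))
     else if j = i + 1 then (1 / (1 + q)) *\<^sub>c ((2 * q) *\<^sub>c bas i - (1 - q) *\<^sub>c bas (i + 1))
     else bas j)"

definition Sbar :: "nat \<Rightarrow> complex \<Rightarrow> nat \<Rightarrow> cvec \<Rightarrow> cvec" where
  "Sbar n q i = (\<lambda>x\<in>spE n. \<Sum>j\<in>{1..n}. x j *\<^sub>c Sbar_bas q i j)"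

lemma sum_cvec_apply: "(\<Sum>j\<in>A. f j) i = (\<Sum>j\<in>A. (f j :: cvec) i)"
  by (induction A rule: infinite_finite_induct) auto

lemma spE_eq: "spE n = {x. \<forall>i. i \<notin> {1..n} \<longrightarrow> x i = 0}"
proof
  have sub: "cvec.subspace {x. \<forall>i. i \<notin> {1..n} \<longrightarrow> x i = 0}"
    by (rule cvec.subspaceI) (auto simp: cscale_def)
  show "spE n \<subseteq> {x. \<forall>i. i \<notin> {1..n} \<longrightarrow> x i = 0}"
    unfolding spE_def
    by (rule cvec.span_minimal[OF _ sub]) (auto simp: bas_def)
  show "{x. \<forall>i. i \<notin> {1..n} \<longrightarrow> x i = 0} \<subseteq> spE n"
  proof
    fix x assume x: "x \<in> {x::cvec. \<forall>i. i \<notin> {1..n} \<longrightarrow> x i = 0}"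
    have "x = (\<Sum>j\<in>{1..n}. x j *\<^sub>c bas j)"
    proof
      fix i
      have "(\<Sum>j\<in>{1..n}. x j *\<^sub>c bas j) i = (\<Sum>j\<in>{1..n}. if j = i then x i else 0)"
        unfolding sum_cvec_apply by (rule sum.cong) (auto simp: cscale_def bas_def)
      then show "x i = (\<Sum>j\<in>{1..n}. x j *\<^sub>c bas j) i" using x by auto
    qed
    moreover have "(\<Sum>j\<in>{1..n}. x j *\<^sub>c bas j) \<in> spE n"
      unfolding spE_def
      by (intro cvec.span_sum cvec.span_scale cvec.span_base) auto
    ultimately show "x \<in> spE n" by simp
  qed
qed

lemma Sbar_coord:
  assumes "i \<in> {1..n-1}" "x \<in> spE n" 
  shows "Sbar n q i x k =
    (if k = i then (x i * (1 - q) + x (i+1) * (2*q)) / (1+q)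
     else if k = i+1 then (x i * 2 - x (i+1) * (1-q)) / (1+q) else x k)"
proof -
  let ?f = "\<lambda>j. x j * Sbar_bas q i j k"
  have "Sbar n q i x k = (\<Sum>j\<in>{1..n}. ?f j)"
    using assms by (simp add: Sbar_def sum_cvec_apply cscale_def)
  also have "\<dots> = (\<Sum>j\<in>{1..n} - {i,i+1}. ?f j) + (\<Sum>j\<in>{i,i+1}. ?f j)"
    using assms(1) by (intro sum.subset_diff) auto
  also have "(\<Sum>j\<in>{1..n} - {i,i+1}. ?f j) = (\<Sum>j\<in>{1..n} - {i,i+1}. if j = k then x k else 0)"
    by (intro sum.cong) (auto simp: Sbar_bas_def bas_def)
  also have "\<dots> = (if k \<in> {i,i+1} then 0 else x k)"
    using assms(2) unfolding spE_eq by (auto)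
  also have "(\<Sum>j\<in>{i,i+1}. ?f j) = x i * Sbar_bas q i i k + x (i+1) * Sbar_bas q i (i+1) k" by simp
  finally show ?thesis
    by (auto simp: Sbar_bas_def cscale_def bas_def algebra_simps add_divide_distrib diff_divide_distrib split: if_splits)
qed

lemma Sbar_in_spE: "i \<in> {1..n-1} \<Longrightarrow> x \<in> spE n \<Longrightarrow> Sbar n q i x \<in> spE n"
  using Sbar_coord[of i n x q] by (auto simp: spE_eq)

lemma Sbar_sq:
  assumes "q \<noteq> -1" "i \<in> {1..n-1}" "x \<in> spE n"
  shows "Sbar n q i (Sbar n q i x) = x"
proof
  fix k
  have q: "1 + q \<noteq> 0" using assms(1) by (simp add: add_eq_0_iff)
  have A: "((a * (1 - q) + b * (2*q)) / (1+q) * (1 - q) + (a * 2 - b * (1-q)) / (1+q) * (2*q)) / (1+q) = a"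
    and B: "((a * (1 - q) + b * (2*q)) / (1+q) * 2 - (a * 2 - b * (1-q)) / (1+q) * (1-q)) / (1+q) = b" for a b
  proof -
    have "(a * (1 - q) + b * (2*q)) * (1 - q) + (a * 2 - b * (1-q)) * (2*q) = a * ((1+q)*(1+q))"
     "(a * (1 - q) + b * (2*q)) * 2 - (a * 2 - b * (1-q)) * (1-q) = b * ((1+q)*(1+q))" by algebra+
    note * = this
    have r: "(u / (1+q) * s + v / (1+q) * t) / (1+q) = (u*s+v*t)/((1+q)*(1+q))" 
       "(u / (1+q) * s - v / (1+q) * t) / (1+q) = (u*s-v*t)/((1+q)*(1+q))" for u v s t
      by (simp_all add: add_divide_distrib diff_divide_distrib)
    show "((a * (1 - q) + b * (2*q)) / (1+q) * (1 - q) + (a * 2 - b * (1-q)) / (1+q) * (2*q)) / (1+q) = a"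
     "((a * (1 - q) + b * (2*q)) / (1+q) * 2 - (a * 2 - b * (1-q)) / (1+q) * (1-q)) / (1+q) = b"
      unfolding r * using q by simp_all
  qed
  show "Sbar n q i (Sbar n q i x) k = x k"
    unfolding Sbar_coord[OF assms(2) Sbar_in_spE[OF assms(2,3)]] Sbar_coord[OF assms(2,3)]
    using A B by simp
qed

lemma Sbar_comm:
  assumes "i \<in> {1..n-1}" "j \<in> {1..n-1}" "\<bar>int i - int j\<bar> > 1" "x \<in> spE n"
  shows "Sbar n q i (Sbar n q j x) = Sbar n q j (Sbar n q i x)"
proof
  fix k
  have "i \<noteq> j" "i \<noteq> j+1" "j \<noteq> i+1" using assms(3) by auto
  then show "Sbar n q i (Sbar n q j x) k = Sbar n q j (Sbar n q i x) k"
    unfolding Sbar_coord[OF assms(1) Sbar_in_spE[OF assms(2,4)]] Sbar_coord[OF assms(2) Sbar_in_spE[OF assms(1,4)]]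
     Sbar_coord[OF assms(1,4)] Sbar_coord[OF assms(2,4)] by auto
qed

lemma Sbar_form:
  assumes "q \<noteq> -1" "i \<in> {1..n-1}" "x \<in> spE n" "y \<in> spE n"
  shows "bform n q (Sbar n q i x) (Sbar n q i y) = bform n q x y"
proof -
  have q: "1 + q \<noteq> 0" using assms(1) by (simp add: add_eq_0_iff)
  have i: "i \<ge> 1" using assms(2) by auto
  let ?g = "\<lambda>x y j. q ^ (j - 1) * x j * y j"
  have split: "bform n q x y = (\<Sum>j\<in>{1..n} - {i,i+1}. ?g x y j) + (?g x y i + ?g x y (i+1))" for x y
  proof -
    have "bform n q x y = (\<Sum>j\<in>{1..n} - {i,i+1}. ?g x y j) + (\<Sum>j\<in>{i,i+1}. ?g x y j)"
      unfolding bform_def using assms(2) by (intro sum.subset_diff) auto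
    then show ?thesis by simp
  qed
  have 1: "(\<Sum>j\<in>{1..n} - {i,i+1}. ?g (Sbar n q i x) (Sbar n q i y) j) = (\<Sum>j\<in>{1..n} - {i,i+1}. ?g x y j)"
    by (intro sum.cong) (auto simp: Sbar_coord[OF assms(2,3)] Sbar_coord[OF assms(2,4)])
  define a b c d r where "a = x i" "b = x (i+1)" "c = y i" "d = y (i+1)" "r = q^(i-1)"
  have r: "q ^ (i + 1 - 1) = q * r" using i by (simp add: a_b_c_d_r_def flip: power_Suc)
  have key: "((a * (1 - q) + b * (2*q)) / (1+q)) * ((c * (1 - q) + d * (2*q)) / (1+q))
      + q * ((a * 2 - b * (1-q)) / (1+q)) * ((c * 2 - d * (1-q)) / (1+q)) = a * c + q * b * d"
  proof -
    have "(a * (1 - q) + b * (2*q)) * (c * (1 - q) + d * (2*q)) + q * (a * 2 - b * (1-q)) * (c * 2 - d * (1-q))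
      = (1+q)*(1+q) * (a * c + q * b * d)" by algebra
    then show ?thesis using q by (simp add: divide_simps)
  qed
  have 2: "?g (Sbar n q i x) (Sbar n q i y) i + ?g (Sbar n q i x) (Sbar n q i y) (i+1) = ?g x y i + ?g x y (i+1)"
  proof -
    have *: "r * u * v + q * r * u' * v' = r * (u * v + q * u' * v')" for u v u' v' by (simp add: algebra_simps)
    have L: "Sbar n q i x i = (a * (1 - q) + b * (2*q)) / (1+q)" "Sbar n q i x (i+1) = (a * 2 - b * (1-q)) / (1+q)"
        "Sbar n q i y i = (c * (1 - q) + d * (2*q)) / (1+q)" "Sbar n q i y (i+1) = (c * 2 - d * (1-q)) / (1+q)"
      by (simp_all add: Sbar_coord[OF assms(2,3)] Sbar_coord[OF assms(2,4)] a_b_c_d_r_def)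
    show ?thesis unfolding r a_b_c_d_r_def(5)[symmetric] a_b_c_d_r_def(1-4)[symmetric] * L key ..
  qed
  show ?thesis unfolding split 1 2 ..
qed

lemma Sbar_orth:
  assumes "q \<noteq> -1" "i \<in> {1..n-1}"
  shows "Sbar n q i \<in> carrier (orth_group n q (spE n))"
proof -
  have add: "x + y \<in> spE n" and sc: "c *\<^sub>c x \<in> spE n" if "x \<in> spE n" "y \<in> spE n" for x y c
    using that by (auto simp: spE_eq cscale_def)
  have "Sbar n q i \<in> lin_ops (spE n)"
    unfolding lin_ops_def
  proof (intro CollectI conjI ballI allI)
    show "Sbar n q i \<in> spE n \<rightarrow>\<^sub>E spE n"
      using Sbar_in_spE[OF assms(2)] by (auto simp del: One_nat_def) (simp add: Sbar_def)
    show "Sbar n q i (x + y) = Sbar n q i x + Sbar n q i y" if xy: "x \<in> spE n" "y \<in> spE n" for x y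
      by (rule ext) (simp add: Sbar_coord[OF assms(2)] xy add add_divide_distrib diff_divide_distrib algebra_simps)
    show "Sbar n q i (c *\<^sub>c x) = c *\<^sub>c Sbar n q i x" if xy: "x \<in> spE n" for x c
      unfolding cscale_def[of c "Sbar n q i x"]
      by (rule ext, unfold Sbar_coord[OF assms(2) sc[OF xy xy]] Sbar_coord[OF assms(2) xy]) (simp add: cscale_def add_divide_distrib diff_divide_distrib algebra_simps)
  qed
  moreover have "bij_betw (Sbar n q i) (spE n) (spE n)"
    by (rule bij_betw_byWitness[where f' = "Sbar n q i"])
      (use Sbar_sq[OF assms] Sbar_in_spE[OF assms(2)] in auto)
  ultimately show ?thesis
    using Sbar_form[OF assms] by (auto simp: orth_group_def Bij_def lin_ops_def PiE_def)
qed

section \<open>Existence of the reflection representation\<close>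

lemma pres_eq_words: "pres_eq X R v w \<Longrightarrow> v \<in> lists (X \<times> UNIV) \<and> w \<in> lists (X \<times> UNIV)"
  by (induction rule: pres_eq.induct) auto

lemma pres_eq_ctx:
  assumes "pres_eq X R v w" "a \<in> lists (X \<times> UNIV)" "b \<in> lists (X \<times> UNIV)"
  shows "pres_eq X R (a @ v @ b) (a @ w @ b)"
  using assms
proof (induction rule: pres_eq.induct)
  case (pres_refl w) then show ?case by (intro pres_eq.pres_refl) auto
next
  case (pres_sym v w) show ?case by (rule pres_eq.pres_sym[OF pres_sym.IH[OF pres_sym.prems]])
next
  case (pres_trans u v w) show ?case by (rule pres_eq.pres_trans[OF pres_trans.IH(1)[OF pres_trans.prems] pres_trans.IH(2)[OF pres_trans.prems]])
next
  case (pres_cancel u v x bb)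
  then show ?case using pres_eq.pres_cancel[of "a @ u" X "v @ b" x R bb] by simp
next
  case (pres_rel u v r s)
  then show ?case using pres_eq.pres_rel[of "a @ u" X "v @ b" r s R] by simp
qed

lemma pres_class_eqI: 
  assumes "pres_eq X R v w" shows "pres_class X R v = pres_class X R w"
  unfolding pres_class_def using pres_trans[OF assms] pres_trans[OF pres_sym[OF assms]] by auto

lemma pres_mult:
  assumes "v \<in> lists (X \<times> UNIV)" "w \<in> lists (X \<times> UNIV)"
  shows "pres_class X R v \<otimes>\<^bsub>presented_group X R\<^esub> pres_class X R w = pres_class X R (v @ w)"
proof -
  have "pres_class X R (a @ b) = pres_class X R (v @ w)"
    if "a \<in> pres_class X R v" "b \<in> pres_class X R w" for a b
  proof -
    have ab: "pres_eq X R v a" "pres_eq X R w b" using that by (auto simp: pres_class_def)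
    have "pres_eq X R ([] @ v @ w) ([] @ a @ w)"
      by (rule pres_eq_ctx[OF ab(1)]) (use assms in auto)
    moreover have "pres_eq X R (a @ w @ []) (a @ b @ [])"
      by (rule pres_eq_ctx[OF ab(2)]) (use pres_eq_words[OF ab(1)] in auto)
    ultimately have *: "pres_eq X R (v @ w) (a @ w)" "pres_eq X R (a @ w) (a @ b)" by simp_all
    have "pres_eq X R (v @ w) (a @ b)" by (rule pres_trans[OF *])
    then show ?thesis by (rule pres_class_eqI[symmetric])
  qed
  note 1 = this
  have 2: "v \<in> pres_class X R v" "w \<in> pres_class X R w"
    unfolding pres_class_def using pres_refl[OF assms(1)] pres_refl[OF assms(2)] by simp_all
  have "(\<Union>a\<in>pres_class X R v. \<Union>b\<in>pres_class X R w. pres_class X R (a @ b)) = pres_class X R (v @ w)"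
  proof (intro equalityI subsetI)
    fix z assume "z \<in> (\<Union>a\<in>pres_class X R v. \<Union>b\<in>pres_class X R w. pres_class X R (a @ b))"
    then show "z \<in> pres_class X R (v @ w)" using 1 by (elim UN_E) simp
  next
    fix z assume "z \<in> pres_class X R (v @ w)"
    then show "z \<in> (\<Union>a\<in>pres_class X R v. \<Union>b\<in>pres_class X R w. pres_class X R (a @ b))"
      by (intro UN_I[OF 2(1)] UN_I[OF 2(2)])
  qed
  then show ?thesis by (simp add: presented_group_def)
qed

lemma group_presented_group: "group (presented_group X R)"
proof (rule groupI)
  let ?G = "presented_group X R"
  have C: "carrier ?G = pres_class X R ` lists (X \<times> UNIV)" "\<one>\<^bsub>?G\<^esub> = pres_class X R []" 
    by (simp_all add: presented_group_def)
  show "\<one>\<^bsub>?G\<^esub> \<in> carrier ?G" unfolding C by (intro imageI) auto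
  fix x assume "x \<in> carrier ?G"
  then obtain v where v: "v \<in> lists (X \<times> UNIV)" "x = pres_class X R v" unfolding C by blast
  show "\<one>\<^bsub>?G\<^esub> \<otimes>\<^bsub>?G\<^esub> x = x" unfolding C v using pres_mult[of "[]" X v R] v by simp
  have "\<exists>w \<in> lists (X \<times> UNIV). pres_eq X R (w @ v) []" using v(1)
  proof (induction v)
    case Nil then show ?case by (intro bexI[of _ "[]"]) (auto intro: pres_refl)
  next
    case (Cons a v)
    obtain x b where a: "a = (x,b)" by (cases a)
    have x: "x \<in> X" and v: "v \<in> lists (X \<times> UNIV)" using Cons a by auto
    from Cons obtain w where w: "w \<in> lists (X \<times> UNIV)" "pres_eq X R (w @ v) []" by auto
    have "pres_eq X R (w @ [(x,\<not>b),(x,\<not>\<not>b)] @ v) (w @ v)"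
      by (rule pres_cancel) (use w v x in auto)
    from pres_trans[OF this w(2)] have "pres_eq X R ((w @ [(x,\<not>b)]) @ (a # v)) []"
      by (simp add: a)
    moreover have "w @ [(x,\<not>b)] \<in> lists (X \<times> UNIV)" using w x by auto
    ultimately show ?case by blast
  qed
  then obtain w where w: "w \<in> lists (X \<times> UNIV)" "pres_eq X R (w @ v) []" by blast
  then show "\<exists>y\<in>carrier ?G. y \<otimes>\<^bsub>?G\<^esub> x = \<one>\<^bsub>?G\<^esub>"
    unfolding C v(2) by (intro bexI[of _ "pres_class X R w"]) (auto simp: pres_mult v(1) pres_class_eqI)
  fix y assume "y \<in> carrier ?G"
  then obtain u where u: "u \<in> lists (X \<times> UNIV)" "y = pres_class X R u" unfolding C by blast
  show "x \<otimes>\<^bsub>?G\<^esub> y \<in> carrier ?G" unfolding v u pres_mult[OF v(1) u(1)] C using u v by (intro imageI) auto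
  fix z assume "z \<in> carrier ?G"
  then obtain t where t: "t \<in> lists (X \<times> UNIV)" "z = pres_class X R t" unfolding C by blast
  show "x \<otimes>\<^bsub>?G\<^esub> y \<otimes>\<^bsub>?G\<^esub> z = x \<otimes>\<^bsub>?G\<^esub> (y \<otimes>\<^bsub>?G\<^esub> z)"
  proof -
    have uv: "v @ u \<in> lists (X \<times> UNIV)" "u @ t \<in> lists (X \<times> UNIV)" using u(1) v(1) t(1) by auto
    show ?thesis
      unfolding v(2) u(2) t(2) pres_mult[OF v(1) u(1)] pres_mult[OF u(1) t(1)] pres_mult[OF uv(1) t(1)] pres_mult[OF v(1) uv(2)] append_assoc ..
  qed
qed

primrec weval :: "('g, 'm) monoid_scheme \<Rightarrow> ('a \<Rightarrow> 'g) \<Rightarrow> 'a gword \<Rightarrow> 'g" where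
  "weval G f [] = \<one>\<^bsub>G\<^esub>"
| "weval G f (l # w) = (if snd l then f (fst l) else inv\<^bsub>G\<^esub> (f (fst l))) \<otimes>\<^bsub>G\<^esub> weval G f w"

context group begin
lemma weval_closed: "f \<in> X \<rightarrow> carrier G \<Longrightarrow> w \<in> lists (X \<times> UNIV) \<Longrightarrow> weval G f w \<in> carrier G"
  by (induction w) (auto simp: Pi_iff)
lemma weval_append:
  assumes f: "f \<in> X \<rightarrow> carrier G" and "v \<in> lists (X \<times> UNIV)" and w: "w \<in> lists (X \<times> UNIV)"
  shows "weval G f (v @ w) = weval G f v \<otimes> weval G f w"
  using assms(2)
proof (induction v)
  case Nil
  then show ?case using weval_closed[OF f w] by simp
next
  case (Cons l v)
  then have v: "v \<in> lists (X \<times> UNIV)" "fst l \<in> X" by auto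
  then have "f (fst l) \<in> carrier G" using f by auto
  then show ?case using Cons.IH weval_closed[OF f w] weval_closed[OF f v(1)] by (simp add: m_assoc)
qed

lemma weval_pres_eq:
  assumes f: "f \<in> X \<rightarrow> carrier G" and R: "\<And>r s. (r,s) \<in> R \<Longrightarrow> weval G f r = weval G f s"
    and e: "pres_eq X R v w"
  shows "weval G f v = weval G f w"
  using e
proof (induction rule: pres_eq.induct)
  case (pres_cancel u v x b)
  then have x: "f x \<in> carrier G" using f by auto
  have "weval G f ([(x,b),(x,\<not>b)] @ v) = weval G f v"
    using x weval_closed[OF f pres_cancel(2)] by (cases b) (simp_all flip: m_assoc)
  then show ?case using pres_cancel by (subst (1 2) weval_append[OF f]) auto
next
  case (pres_rel u v r s)
  then show ?case using R[OF pres_rel(5)] by (simp add: weval_append[OF f])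
qed auto

lemma presented_hom_ex:
  assumes f: "f \<in> X \<rightarrow> carrier G" and R: "\<And>r s. (r,s) \<in> R \<Longrightarrow> weval G f r = weval G f s"
  shows "\<exists>h\<in>hom (presented_group X R) G. \<forall>x\<in>X. h (pres_class X R [(x,True)]) = f x"
proof -
  define h where "h = (\<lambda>A. weval G f (SOME w. w \<in> A))"
  have h: "h (pres_class X R w) = weval G f w" if "w \<in> lists (X \<times> UNIV)" for w
  proof -
    have "w \<in> pres_class X R w" using that by (auto simp: pres_class_def intro: pres_refl)
    then have "(SOME v. v \<in> pres_class X R w) \<in> pres_class X R w" by (rule someI)
    then show ?thesis using weval_pres_eq[OF f R] by (simp add: h_def pres_class_def)
  qed
  have "h \<in> hom (presented_group X R) G"
  proof (rule homI)
    fix A B assume "A \<in> carrier (presented_group X R)" "B \<in> carrier (presented_group X R)"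
    then obtain v w where "v \<in> lists (X \<times> UNIV)" "A = pres_class X R v" "w \<in> lists (X \<times> UNIV)" "B = pres_class X R w"
      by (auto simp: presented_group_def)
    moreover from this have "v @ w \<in> lists (X \<times> UNIV)" by auto
    ultimately show "h (A \<otimes>\<^bsub>presented_group X R\<^esub> B) = h A \<otimes> h B" 
      by (simp add: pres_mult h weval_append[OF f])
  next
    fix A assume "A \<in> carrier (presented_group X R)"
    then obtain v where "v \<in> lists (X \<times> UNIV)" "A = pres_class X R v"
      by (auto simp: presented_group_def)
    then show "h A \<in> carrier G" using h weval_closed[OF f] by simp
  qed
  moreover have "h (pres_class X R [(x,True)]) = f x" if "x \<in> X" for x
    using h[of "[(x,True)]"] that f r_one[of "f x"] by (auto simp: Pi_iff)
  ultimately show ?thesis by blast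
qed
end

lemma orth_mult: "g \<in> Bij V \<Longrightarrow> h \<in> Bij V \<Longrightarrow> g \<otimes>\<^bsub>orth_group n q V\<^esub> h = compose V g h"
  by (simp add: orth_group_def BijGroup_def)

lemma group_orth_group:
  assumes "cvec.subspace V"
  shows "group (orth_group n q V)"
proof -
  let ?C = "{T \<in> lin_ops V \<inter> Bij V. \<forall>x\<in>V. \<forall>y\<in>V. bform n q (T x) (T y) = bform n q x y}"
  interpret B: group "BijGroup V" by (rule group_BijGroup)
  have V: "x + y \<in> V" "c *\<^sub>c x \<in> V" if "x \<in> V" "y \<in> V" for x y c
    using assms that by (auto simp: cvec.subspace_def)
  have lin: "T \<in> lin_ops V \<longleftrightarrow> (\<forall>x\<in>V. \<forall>y\<in>V. T (x + y) = T x + T y) \<and> (\<forall>c. \<forall>x\<in>V. T (c *\<^sub>c x) = c *\<^sub>c T x)" if "T \<in> Bij V" for T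
    using that Bij_imp_funcset[OF that] by (auto simp: lin_ops_def Bij_def PiE_def)
  have "subgroup ?C (BijGroup V)"
  proof (rule B.subgroupI)
    show "?C \<subseteq> carrier (BijGroup V)" by (auto simp: BijGroup_def)
    have "(\<lambda>x\<in>V. x) \<in> ?C" by (simp add: lin id_Bij V)
    then show "?C \<noteq> {}" by blast
  next
    fix a assume a: "a \<in> ?C"
    then have aB: "a \<in> Bij V" by simp
    then have inv: "inv\<^bsub>BijGroup V\<^esub> a = restrict (inv_into V a) V" by (rule inv_BijGroup)
    define b where "b = inv\<^bsub>BijGroup V\<^esub> a"
    have bB: "b \<in> Bij V" using aB unfolding b_def inv by (rule restrict_inv_into_Bij)
    have bV: "b x \<in> V" if "x \<in> V" for x using Bij_imp_funcset[OF bB] that by auto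
    have aV: "a x \<in> V" if "x \<in> V" for x using Bij_imp_funcset[OF aB] that by auto
    have ab: "a (b x) = x" "b (a x) = x" if "x \<in> V" for x
      using that aB aV unfolding b_def inv by (auto simp: Bij_def bij_betw_def f_inv_into_f)
    have inj: "u = v" if "u \<in> V" "v \<in> V" "a u = a v" for u v using ab(2) that by metis
    have "b (x + y) = b x + b y" if "x \<in> V" "y \<in> V" for x y
      by (rule inj) (use a lin[OF aB] that in \<open>auto simp: ab V bV\<close>)
    moreover have "b (c *\<^sub>c x) = c *\<^sub>c b x" if "x \<in> V" for x c
      by (rule inj) (use a lin[OF aB] that in \<open>auto simp: ab V bV\<close>)
    moreover have "bform n q (b x) (b y) = bform n q x y" if "x \<in> V" "y \<in> V" for x y
    proof -
      have "\<forall>x\<in>V. \<forall>y\<in>V. bform n q (a x) (a y) = bform n q x y" using a by simp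
      from this[THEN bspec, OF bV[OF that(1)], THEN bspec, OF bV[OF that(2)]]
      show ?thesis by (simp add: ab that)
    qed
    ultimately show "inv\<^bsub>BijGroup V\<^esub> a \<in> ?C" using bB lin[OF bB] by (simp flip: b_def)
  next
    fix a b assume ab: "a \<in> ?C" "b \<in> ?C"
    then have B: "a \<in> Bij V" "b \<in> Bij V" by auto
    have bV: "b x \<in> V" if "x \<in> V" for x using Bij_imp_funcset[OF B(2)] that by auto
    have "compose V a b \<in> ?C"
      using ab lin[OF B(1)] lin[OF B(2)] lin[OF compose_Bij[OF B]] compose_Bij[OF B]
      by (auto simp: compose_def V bV)
    then show "a \<otimes>\<^bsub>BijGroup V\<^esub> b \<in> ?C" using B by (simp add: BijGroup_def)
  qed
  then show ?thesis unfolding orth_group_def by (rule B.subgroup_imp_group)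
qed

lemma orth_group_one: "\<one>\<^bsub>orth_group n q V\<^esub> = (\<lambda>x\<in>V. x)"
  by (simp add: orth_group_def BijGroup_def)

theorem reflection_rep_exists:
  assumes "q \<noteq> -1"
  shows "\<exists>\<rho>\<in>hom (TW n) (orth_group n q (spE n)). \<forall>i\<in>{1..n-1}. \<rho> (tw_gen n i) = Sbar n q i"
proof -
  let ?O = "orth_group n q (spE n)"
  have "cvec.subspace (spE n)" unfolding spE_def by (rule cvec.subspace_span)
  then interpret O: group ?O by (rule group_orth_group)
  have S: "Sbar n q i \<in> carrier ?O" "Sbar n q i \<in> Bij (spE n)" if "i \<in> {1..n-1}" for i
    using Sbar_orth[OF assms that] by (auto simp: orth_group_def)
  have "weval ?O (Sbar n q) r = weval ?O (Sbar n q) s" if "(r,s) \<in> TW_rels n" for r s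
  proof -
    from that consider i where "i \<in> {1..n-1}" "r = [(i,True),(i,True)]" "s = []" |
      i j where "i \<in> {1..n-1}" "j \<in> {1..n-1}" "\<bar>int i - int j\<bar> > 1" "r = [(i,True),(j,True)]" "s = [(j,True),(i,True)]"
      unfolding TW_rels_def by blast
    then show ?thesis
    proof cases
      case 1
      then show ?thesis using S[OF 1(1)]
        Sbar_sq[OF assms 1(1)] O.r_one[OF S(1)[OF 1(1)]] orth_mult[OF S(2)[OF 1(1)] S(2)[OF 1(1)], of n q]
        unfolding 1(2,3) by (simp add: orth_group_one compose_def cong: restrict_cong)
    next
      case 2
      then show ?thesis using O.r_one[OF S(1)[OF 2(1)]] O.r_one[OF S(1)[OF 2(2)]] Sbar_comm[OF 2(1-3)]
        orth_mult[OF S(2)[OF 2(1)] S(2)[OF 2(2)], of n q] orth_mult[OF S(2)[OF 2(2)] S(2)[OF 2(1)], of n q]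
        unfolding 2(4,5) by (simp add: compose_def cong: restrict_cong)
    qed
  qed
  note R = this
  have "Sbar n q \<in> {1..n-1} \<rightarrow> carrier ?O" using S(1) by (rule Pi_I)
  from O.presented_hom_ex[OF this R] show ?thesis
    unfolding TW_def tw_gen_def .
qed

section \<open>The factor \<open>O(L)\<close>\<close>

text \<open>Every \<open>Sbar n q i\<close> fixes \<^term>\<open>ell0 n\<close>, so the image of the reflection representation acts
  trivially on \<open>L\<close>. As \<open>O(L) = {1, -1}\<close>, that image is never Zariski-dense in the full product
  \<open>O(L) \<times> O(F)\<close>; the subgroup in which it can be dense is the copy of \<open>O(F)\<close> consisting of the
  elements of \<^const>\<open>orth_prod\<close> that fix \<open>L\<close> pointwise.\<close>

theorem image_not_dense_in_orth_prod:
  assumes n: "n \<ge> 2" and q: "q \<noteq> -1"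
    and rho: "\<rho> \<in> hom (TW n) (orth_group n q (spE n))"
    and gen: "\<And>i. i \<in> {1..n-1} \<Longrightarrow> \<rho> (tw_gen n i) = Sbar n q i"
  shows "\<not> zariski_dense (spE n) (\<rho> ` carrier (TW n)) (orth_prod n q)"
proof
  assume "zariski_dense (spE n) (\<rho> ` carrier (TW n)) (orth_prod n q)"
  then have d: "(subtopology (zariski (spE n)) (orth_prod n q)) closure_of (\<rho> ` carrier (TW n)) = orth_prod n q"
    by (simp add: zariski_dense_def)
  have ell: "ell0 n k = (if k \<in> {1..n} then 1 else 0)" for k
    by (simp add: ell0_def sum_cvec_apply bas_def)
  have ellE: "ell0 n \<in> spE n" by (auto simp: spE_eq ell)
  let ?O = "orth_group n q (spE n)" and ?T = "TW n"
  have sE: "cvec.subspace (spE n)" unfolding spE_def by (rule cvec.subspace_span)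
  interpret O: group ?O using sE by (rule group_orth_group)
  interpret T: group ?T unfolding TW_def by (rule group_presented_group)
  interpret h: group_hom ?T ?O \<rho> using rho by unfold_locales
  have Bij: "g \<in> Bij (spE n)" if "g \<in> carrier ?O" for g using that by (auto simp: orth_group_def)
  let ?X = "{1..n-1}"
  have Sfix: "Sbar n q i (ell0 n) = ell0 n" if "i \<in> ?X" for i
  proof
    fix k show "Sbar n q i (ell0 n) k = ell0 n k"
      unfolding Sbar_coord[OF that ellE] using that q
      by (auto simp: ell divide_simps add_eq_0_iff)
  qed
  let ?c = "pres_class ?X (TW_rels n)"
  have mult: "?c (v @ w) = ?c v \<otimes>\<^bsub>?T\<^esub> ?c w" if "v \<in> lists (?X \<times> UNIV)" "w \<in> lists (?X \<times> UNIV)" for v w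
    using pres_mult[OF that] by (simp add: TW_def)
  have carr: "?c w \<in> carrier ?T" if "w \<in> lists (?X \<times> UNIV)" for w
    using that by (simp add: TW_def presented_group_def)
  have letter: "?c [(i,b)] = tw_gen n i" if "i \<in> ?X" for i b
  proof -
    have 1: "tw_gen n i \<otimes>\<^bsub>?T\<^esub> tw_gen n i = \<one>\<^bsub>?T\<^esub>"
    proof -
      have "pres_eq ?X (TW_rels n) ([] @ [(i,True),(i,True)] @ []) ([] @ [] @ [])"
        by (rule pres_rel) (use that in \<open>auto simp: TW_rels_def\<close>)
      from pres_class_eqI[OF this] show ?thesis
        using mult[of "[(i,True)]" "[(i,True)]"] that by (simp add: tw_gen_def TW_def presented_group_def)
    qed
    have 2: "tw_gen n i \<otimes>\<^bsub>?T\<^esub> ?c [(i,False)] = \<one>\<^bsub>?T\<^esub>"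
    proof -
      have "pres_eq ?X (TW_rels n) ([] @ [(i,True),(i,\<not>True)] @ []) ([] @ [])"
        by (rule pres_cancel) (use that in auto)
      from pres_class_eqI[OF this] show ?thesis
        using mult[of "[(i,True)]" "[(i,False)]"] that by (simp add: tw_gen_def TW_def presented_group_def)
    qed
    have c: "tw_gen n i \<in> carrier ?T" "?c [(i,False)] \<in> carrier ?T"
      using that carr by (auto simp: tw_gen_def)
    have "?c [(i,False)] = tw_gen n i" using T.inv_unique[OF 1 2 c(1) c(1) c(2)] by (rule sym)
    then show ?thesis by (cases b) (simp_all add: tw_gen_def)
  qed
  have fixw: "\<rho> (?c w) (ell0 n) = ell0 n" if "w \<in> lists (?X \<times> UNIV)" for w
    using that
  proof (induction w)
    case Nil
    have "?c [] = \<one>\<^bsub>?T\<^esub>" by (simp add: TW_def presented_group_def)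
    then show ?case using h.hom_one ellE by (simp add: orth_group_one)
  next
    case (Cons l w)
    obtain i b where l: "l = (i,b)" by (cases l)
    have i: "i \<in> ?X" and w: "w \<in> lists (?X \<times> UNIV)" using Cons l by auto
    have lw: "?c (l # w) = tw_gen n i \<otimes>\<^bsub>?T\<^esub> ?c w"
      using mult[of "[l]" w] letter[OF i, of b] i w l by auto
    have ti: "tw_gen n i \<in> carrier ?T" using carr[of "[(i,True)]"] i by (simp add: tw_gen_def)
    have "\<rho> (?c (l # w)) = compose (spE n) (Sbar n q i) (\<rho> (?c w))"
      unfolding lw h.hom_mult[OF ti carr[OF w]] gen[OF i, symmetric]
      by (intro orth_mult Bij h.hom_closed ti carr w)
    then show ?case using Cons ellE Sfix[OF i] by (simp add: compose_def)
  qed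
  let ?m = "\<lambda>V. \<lambda>x\<in>V. - (x::cvec)"
  have m: "?m V \<in> carrier (orth_group n q V)" if s: "cvec.subspace V" for V
  proof -
    have V: "x + y \<in> V" "c *\<^sub>c x \<in> V" "- x \<in> V" if "x \<in> V" "y \<in> V" for x y c
      using s that cvec.subspace_neg[OF s] by (auto simp: cvec.subspace_def)
    have "bij_betw (?m V) V V"
      by (rule bij_betw_byWitness[where f' = "?m V"]) (auto simp: V)
    then show ?thesis
      using V by (auto simp: orth_group_def lin_ops_def Bij_def bform_def)
  qed
  have sub: "spL n \<subseteq> spE n" "spF n q \<subseteq> spE n"
  proof -
    show "spL n \<subseteq> spE n" unfolding spL_def
      by (rule cvec.span_minimal[OF _ sE]) (use ellE in simp)
    have "q *\<^sub>c bas i - bas (i + 1) \<in> spE n" if "i \<in> {1..n-1}" for i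
      using that by (auto simp: spE_eq bas_def cscale_def)
    then show "spF n q \<subseteq> spE n" unfolding spF_def
      by (intro cvec.span_minimal[OF _ sE] image_subsetI)
  qed
  have "restrict (?m (spE n)) (spL n) = ?m (spL n)" "restrict (?m (spE n)) (spF n q) = ?m (spF n q)"
    using sub by (auto simp: restrict_def fun_eq_iff)
  then have mO: "?m (spE n) \<in> orth_prod n q"
    unfolding orth_prod_def using m[OF sE] m[of "spL n"] m[of "spF n q"]
    by (auto simp: spL_def spF_def)
  have pf: "(\<lambda>T. T (ell0 n) 1 + (-1)) \<in> poly_funs (spE n)"
    by (intro poly_funs.add poly_funs.const poly_funs.coord ellE)
  let ?U = "lin_ops (spE n) - {T \<in> lin_ops (spE n). \<forall>p\<in>{\<lambda>T. T (ell0 n) 1 + (-1)}. p T = 0}"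
  have U: "openin (zariski (spE n)) ?U" unfolding openin_zariski using pf by blast
  have mU: "?m (spE n) \<in> ?U" using m[OF sE] ellE n by (auto simp: orth_group_def ell)
  have "?m (spE n) \<in> (subtopology (zariski (spE n)) (orth_prod n q)) closure_of (\<rho> ` carrier (TW n))"
    using mO d by simp
  then have "?m (spE n) \<in> zariski (spE n) closure_of (orth_prod n q \<inter> \<rho> ` carrier (TW n))"
    unfolding closure_of_subtopology by simp
  then have "\<forall>T. ?m (spE n) \<in> T \<and> openin (zariski (spE n)) T \<longrightarrow>
     (\<exists>y. y \<in> orth_prod n q \<inter> \<rho> ` carrier (TW n) \<and> y \<in> T)"
    unfolding in_closure_of by (rule conjunct2)
  from this[THEN spec, THEN mp, OF conjI[OF mU U]]
  have "\<exists>y. y \<in> orth_prod n q \<inter> \<rho> ` carrier (TW n) \<and> y \<in> ?U" .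
  then obtain g where g: "g \<in> carrier (TW n)" "\<rho> g \<in> ?U" by auto
  from g(1) obtain w where "w \<in> lists (?X \<times> UNIV)" "g = ?c w" unfolding TW_def presented_group_def by auto
  with fixw have "\<rho> g (ell0 n) = ell0 n" by simp
  with g(2) n show False by (simp add: ell)
qed

end

theory Submission
  imports Defs "HOL-Analysis.Continuum_Not_Denumerable" "HOL-Computational_Algebra.Polynomial"
begin

text \<open>Write \<open>f\<^sub>i = q e\<^sub>i - e\<^sub>i\<^sub>+\<^sub>1\<close>, so that the generator \<open>t\<^sub>i\<close> acts as the reflection in \<open>f\<^sub>i\<close>. Let \<open>X\<close> be
  the image of the representation and call an anisotropic vector \<open>w\<close> a mirror if its reflection lies
  in the Zariski hull of \<open>X\<close>. The hull is closed under composition, so it suffices to show that every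
  anisotropic \<open>w \<in> F\<close> is a mirror and that these reflections generate the isometries of \<open>E\<close> that fix
  \<open>L\<close>.

  Mirrors are produced from lines. A polynomial function evaluated at the reflection in \<open>a + t b\<close> is,
  after multiplication by a power of the norm \<open>\<langle>a + t b, a + t b\<rangle>\<close>, a polynomial in \<open>t\<close>. Hence, if infinitely
  many points of a line are mirrors, all its anisotropic points are (\<open>mirrors_on_line\<close>). If \<open>u\<close> and
  \<open>v\<close> are mirrors enclosing an angle that is not a rational multiple of \<open>\<pi>\<close>, the dihedral group
  generated by their reflections is infinite, so the plane of \<open>u\<close> and \<open>v\<close> contains infinitely many
  lines of mirrors, and therefore all its anisotropic vectors are mirrors (\<open>mirrors_in_plane\<close>).

  The squared cosine of the angle between \<open>f\<^sub>i\<close> and \<open>f\<^sub>i\<^sub>+\<^sub>1\<close> is \<open>q / (1 + q)\<^sup>2\<close>, and the excluded values of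
  \<open>q\<close> are those for which this angle is a rational multiple of \<open>\<pi>\<close>. So the anisotropic vectors in
  the planes of consecutive \<open>f\<^sub>i\<close> are mirrors. For the span of \<open>f\<^sub>1, \<dots>, f\<^sub>k\<^sub>+\<^sub>1\<close> the argument is inductive: given
  an anisotropic \<open>w = u + c f\<^sub>k\<^sub>+\<^sub>1\<close> with \<open>u\<close> in the span of the first \<open>k\<close>, move \<open>u\<close> along the direction \<open>f\<^sub>k\<close>. The vectors
  \<open>u + t f\<^sub>k\<close> approach the line of \<open>f\<^sub>k\<close> as \<open>t\<close> grows, so each rational angle with \<open>f\<^sub>k\<^sub>+\<^sub>1\<close> occurs for
  at most two values of \<open>t\<close>. There are countably many rational angles and uncountably many \<open>t\<close>, so
  \<open>w + t f\<^sub>k\<close> is a mirror for infinitely many \<open>t\<close>, and thus \<open>w\<close> is a mirror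
  (\<open>mirrors_in_span_of_chain\<close>).

  That reflections generate is the theorem of Cartan and Dieudonne, proved by enlarging an orthogonal
  system of fixed vectors that starts with \<open>\<ell>\<^sub>0\<close> (\<open>isometry_in_hull\<close>). As \<open>[n]\<^sub>q\<close> is the norm of
  \<open>\<ell>\<^sub>0\<close>, its nonvanishing splits \<open>E\<close> into \<open>L\<close> and \<open>F\<close>. An element of \<open>O(F)\<close> extends by the identity
  on \<open>L\<close>, which transfers density from \<open>E\<close> to \<open>F\<close>.\<close>

section \<open>Zariski hulls\<close>

definition zariski_hull :: "cvec set \<Rightarrow> (cvec \<Rightarrow> cvec) set \<Rightarrow> (cvec \<Rightarrow> cvec) set" where
  "zariski_hull V X = {T \<in> lin_ops V. \<forall>p\<in>poly_funs V. (\<forall>S\<in>X. p S = 0) \<longrightarrow> p T = 0}"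

lemma zariski_hullI:
  assumes "T \<in> lin_ops V" "\<And>p. p \<in> poly_funs V \<Longrightarrow> (\<And>S. S \<in> X \<Longrightarrow> p S = 0) \<Longrightarrow> p T = 0"
  shows "T \<in> zariski_hull V X"
  using assms unfolding zariski_hull_def by blast

lemma zariski_hullD:
  assumes "T \<in> zariski_hull V X" "p \<in> poly_funs V" "\<And>S. S \<in> X \<Longrightarrow> p S = 0"
  shows "p T = 0"
  using assms unfolding zariski_hull_def by blast

lemma zariski_hull_lin_ops: "T \<in> zariski_hull V X \<Longrightarrow> T \<in> lin_ops V"
  by (simp add: zariski_hull_def)

lemma zariski_hull_base: "X \<subseteq> lin_ops V \<Longrightarrow> T \<in> X \<Longrightarrow> T \<in> zariski_hull V X"
  by (auto simp: zariski_hull_def)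

lemma zariski_denseI:
  assumes "X \<subseteq> Y" "Y \<subseteq> zariski_hull V X"
  shows "zariski_dense V X Y"
proof -
  have "T \<in> zariski V closure_of X" if "T \<in> Y" for T
    unfolding in_closure_of topspace_zariski
  proof (intro conjI allI impI)
    show "T \<in> lin_ops V"
      using that assms(2) by (auto simp: zariski_hull_def)
  next
    fix U assume "T \<in> U \<and> openin (zariski V) U"
    then obtain P where P: "P \<subseteq> poly_funs V" "U = lin_ops V - {T \<in> lin_ops V. \<forall>p\<in>P. p T = 0}"
      and "T \<in> U"
      unfolding openin_zariski by blast
    then obtain p where p: "p \<in> P" "p T \<noteq> 0" by blast
    have "\<exists>S\<in>X. p S \<noteq> 0"
    proof (rule ccontr)
      assume "\<not> (\<exists>S\<in>X. p S \<noteq> 0)"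
      then have "p T = 0"
        using that assms(2) P(1) p(1) by (intro zariski_hullD[of T V X p]) auto
      with p(2) show False ..
    qed
    then obtain S where S: "S \<in> X" "p S \<noteq> 0" by blast
    moreover have "S \<in> lin_ops V"
      using S(1) assms by (auto simp: zariski_hull_def)
    ultimately show "\<exists>S. S \<in> X \<and> S \<in> U"
      using p P(2) by blast
  qed
  moreover have "Y \<inter> X = X" using assms(1) by blast
  ultimately show ?thesis
    using assms(1) by (auto simp: zariski_dense_def closure_of_subtopology)
qed

lemma cscale_apply: "(c *\<^sub>c x) i = c * x i"
  by (simp add: cscale_def)

lemma lin_opsD:
  assumes "T \<in> lin_ops V"
  shows "x \<in> V \<Longrightarrow> T x \<in> V" "x \<in> V \<Longrightarrow> y \<in> V \<Longrightarrow> T (x + y) = T x + T y"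
    "x \<in> V \<Longrightarrow> T (c *\<^sub>c x) = c *\<^sub>c T x" "T \<in> extensional V"
  using assms by (auto simp: lin_ops_def PiE_def)

lemma lin_ops_compose:
  assumes "cvec.subspace V" "S \<in> lin_ops V" "T \<in> lin_ops V"
  shows "compose V S T \<in> lin_ops V"
proof -
  note S = lin_opsD[OF assms(2)] and T = lin_opsD[OF assms(3)]
  show ?thesis
    unfolding lin_ops_def
  proof (intro CollectI conjI ballI allI)
    show "compose V S T \<in> V \<rightarrow>\<^sub>E V"
      using S(1) T(1) by (simp add: compose_def Pi_iff)
    show "compose V S T (x + y) = compose V S T x + compose V S T y" if "x \<in> V" "y \<in> V" for x y
      using that S(2) T(1,2) cvec.subspace_add[OF assms(1) that] by (simp add: compose_def)
    show "compose V S T (c *\<^sub>c x) = c *\<^sub>c compose V S T x" if "x \<in> V" for c x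
      using that S(3) T(1,3) cvec.subspace_scale[OF assms(1) that] by (simp add: compose_def)
  qed
qed

lemma lin_ops_sum:
  assumes V: "cvec.subspace V" and T: "T \<in> lin_ops V" and "\<And>j. j \<in> A \<Longrightarrow> f j \<in> V"
  shows "T (\<Sum>j\<in>A. c j *\<^sub>c f j) = (\<Sum>j\<in>A. c j *\<^sub>c T (f j))"
proof -
  have z: "T 0 = 0"
    using lin_opsD(3)[OF T cvec.subspace_0[OF V], of 0] by simp
  have "(\<Sum>j\<in>A. c j *\<^sub>c f j) \<in> V \<and> T (\<Sum>j\<in>A. c j *\<^sub>c f j) = (\<Sum>j\<in>A. c j *\<^sub>c T (f j))"
    using assms(3)
  proof (induction A rule: infinite_finite_induct)
    case (insert a A)
    then have "c a *\<^sub>c f a \<in> V" "(\<Sum>j\<in>A. c j *\<^sub>c f j) \<in> V"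
      "T (\<Sum>j\<in>A. c j *\<^sub>c f j) = (\<Sum>j\<in>A. c j *\<^sub>c T (f j))"
      using cvec.subspace_scale[OF V] by auto
    with insert show ?case
      using lin_opsD(2)[OF T, of "c a *\<^sub>c f a" "\<Sum>j\<in>A. c j *\<^sub>c f j"] lin_opsD(3)[OF T, of "f a" "c a"]
        cvec.subspace_add[OF V, of "c a *\<^sub>c f a" "\<Sum>j\<in>A. c j *\<^sub>c f j"]
      by (simp add: plus_fun_def)
  qed (simp_all add: z cvec.subspace_0[OF V])
  then show ?thesis ..
qed

lemma subspace_spE: "cvec.subspace (spE n)"
  unfolding spE_def by (rule cvec.subspace_span)

lemma bas_in_spE: "j \<in> {1..n} \<Longrightarrow> bas j \<in> spE n"
  by (auto simp: spE_eq bas_def)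

lemma spE_expand:
  assumes "x \<in> spE n"
  shows "x = (\<Sum>j\<in>{1..n}. x j *\<^sub>c bas j)"
proof
  fix i
  have "(\<Sum>j\<in>{1..n}. x j *\<^sub>c bas j) i = (\<Sum>j\<in>{1..n}. if j = i then x i else 0)"
    unfolding sum_cvec_apply by (rule sum.cong) (auto simp: cscale_def bas_def)
  then show "x i = (\<Sum>j\<in>{1..n}. x j *\<^sub>c bas j) i"
    using assms by (auto simp: spE_eq)
qed

lemma poly_funs_sum:
  "(\<And>j. j \<in> A \<Longrightarrow> f j \<in> poly_funs V) \<Longrightarrow> (\<lambda>T. \<Sum>j\<in>A. f j T) \<in> poly_funs V"
  by (induction A rule: infinite_finite_induct) (auto intro: poly_funs.intros)

lemma poly_funs_compose_right:
  assumes "S \<in> lin_ops V" "p \<in> poly_funs V"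
  shows "(\<lambda>T. p (compose V T S)) \<in> poly_funs V"
  using assms(2)
proof induction
  case (coord v i)
  then show ?case
    using lin_opsD(1)[OF assms(1)] by (simp add: compose_def poly_funs.coord)
qed (auto intro: poly_funs.intros)

text \<open>The polynomial in \<open>T\<close> comes from expanding \<open>T v\<close> in the standard basis, which is possible only
  if \<open>T v\<close> lies in \<^term>\<open>spE n\<close>; so the two functions agree on operators but not on arbitrary
  functions \<open>T\<close>.\<close>

lemma poly_funs_compose_left:
  assumes "S \<in> lin_ops (spE n)" "p \<in> poly_funs (spE n)"
  shows "\<exists>p'\<in>poly_funs (spE n). \<forall>T\<in>lin_ops (spE n). p' T = p (compose (spE n) S T)"
  using assms(2)
proof induction
  case (const c)
  show ?case by (rule bexI[OF _ poly_funs.const[of c]]) simp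
next
  case (coord v i)
  have "S (T v) i = (\<Sum>j\<in>{1..n}. T v j * S (bas j) i)" if "T \<in> lin_ops (spE n)" for T
  proof -
    have "S (T v) = S (\<Sum>j\<in>{1..n}. T v j *\<^sub>c bas j)"
      using spE_expand[OF lin_opsD(1)[OF that coord]] by simp
    also have "\<dots> = (\<Sum>j\<in>{1..n}. T v j *\<^sub>c S (bas j))"
      by (rule lin_ops_sum[OF subspace_spE assms(1) bas_in_spE])
    finally show ?thesis by (simp add: sum_cvec_apply cscale_def)
  qed
  moreover have "(\<lambda>T. \<Sum>j\<in>{1..n}. T v j * S (bas j) i) \<in> poly_funs (spE n)"
    by (intro poly_funs_sum poly_funs.mult poly_funs.coord poly_funs.const coord)
  ultimately show ?case
    using coord by (intro bexI) (auto simp: compose_def)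
next
  case (add f g)
  then obtain f' g' where "f' \<in> poly_funs (spE n)" "g' \<in> poly_funs (spE n)"
    "\<forall>T\<in>lin_ops (spE n). f' T = f (compose (spE n) S T)"
    "\<forall>T\<in>lin_ops (spE n). g' T = g (compose (spE n) S T)" by auto
  then show ?case by (intro bexI[OF _ poly_funs.add[of f' _ g']]) auto
next
  case (mult f g)
  then obtain f' g' where "f' \<in> poly_funs (spE n)" "g' \<in> poly_funs (spE n)"
    "\<forall>T\<in>lin_ops (spE n). f' T = f (compose (spE n) S T)"
    "\<forall>T\<in>lin_ops (spE n). g' T = g (compose (spE n) S T)" by auto
  then show ?case by (intro bexI[OF _ poly_funs.mult[of f' _ g']]) auto
qed

text \<open>The usual two steps: left translation by an element of \<open>X\<close> is polynomial and preserves \<open>X\<close>,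
  hence preserves the hull. So right translation by an element of the hull maps \<open>X\<close> into the hull,
  hence preserves the hull as well.\<close>

lemma zariski_hull_compose:
  assumes X: "X \<subseteq> lin_ops (spE n)" "\<And>S T. S \<in> X \<Longrightarrow> T \<in> X \<Longrightarrow> compose (spE n) S T \<in> X"
    and S: "S \<in> zariski_hull (spE n) X" and T: "T \<in> zariski_hull (spE n) X"
  shows "compose (spE n) S T \<in> zariski_hull (spE n) X"
proof -
  have lin: "S \<in> lin_ops (spE n)" "T \<in> lin_ops (spE n)"
    using S T by (auto dest: zariski_hull_lin_ops)
  have half: "compose (spE n) R T \<in> zariski_hull (spE n) X" if R: "R \<in> X" for R
  proof (rule zariski_hullI)
    show "compose (spE n) R T \<in> lin_ops (spE n)"
      using that X(1) lin by (auto intro: lin_ops_compose subspace_spE)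
    fix p assume p: "p \<in> poly_funs (spE n)" "\<And>S. S \<in> X \<Longrightarrow> p S = 0"
    obtain p' where p': "p' \<in> poly_funs (spE n)"
      "\<forall>T\<in>lin_ops (spE n). p' T = p (compose (spE n) R T)"
      using poly_funs_compose_left[OF _ p(1)] R X(1) by blast
    have "p' T = 0"
    proof (rule zariski_hullD[OF T p'(1)])
      fix S assume "S \<in> X"
      then show "p' S = 0"
        using p'(2) p(2)[OF X(2)[OF R]] X(1) by auto
    qed
    then show "p (compose (spE n) R T) = 0"
      using p'(2) lin by simp
  qed
  show ?thesis
  proof (rule zariski_hullI)
    show "compose (spE n) S T \<in> lin_ops (spE n)"
      using lin by (auto intro: lin_ops_compose subspace_spE)
    fix p assume p: "p \<in> poly_funs (spE n)" "\<And>S. S \<in> X \<Longrightarrow> p S = 0"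
    show "p (compose (spE n) S T) = 0"
      by (rule zariski_hullD[OF S poly_funs_compose_right[OF lin(2) p(1)]])
        (rule zariski_hullD[OF half p])
  qed
qed

section \<open>The form and its reflections\<close>

lemma bform_commute: "bform n q x y = bform n q y x"
  by (simp add: bform_def mult_ac)

lemma bform_add_left: "bform n q (x + y) z = bform n q x z + bform n q y z"
  and bform_diff_left: "bform n q (x - y) z = bform n q x z - bform n q y z"
  and bform_scale_left: "bform n q (c *\<^sub>c x) z = c * bform n q x z"
  by (simp_all add: bform_def cscale_def algebra_simps sum.distrib sum_subtractf sum_distrib_left)

lemma bform_zero_left: "bform n q 0 z = 0"
  by (simp add: bform_def)

lemma bform_add_right: "bform n q z (x + y) = bform n q z x + bform n q z y"
  and bform_diff_right: "bform n q z (x - y) = bform n q z x - bform n q z y"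
  and bform_scale_right: "bform n q z (c *\<^sub>c x) = c * bform n q z x"
  and bform_zero_right: "bform n q z 0 = 0"
  by (simp_all add: bform_commute[of n q z] bform_add_left bform_diff_left bform_scale_left
      bform_zero_left)

lemmas bform_simps = bform_add_left bform_diff_left bform_scale_left bform_zero_left
  bform_add_right bform_diff_right bform_scale_right bform_zero_right

lemma bform_sum_left: "bform n q (\<Sum>a\<in>A. c a *\<^sub>c f a) y = (\<Sum>a\<in>A. c a * bform n q (f a) y)"
proof (induction A rule: infinite_finite_induct)
  case (insert x F)
  then show ?case by (simp add: bform_simps del: plus_fun_apply)
qed (simp_all add: bform_zero_left del: zero_fun_apply)

lemma bform_bas:
  assumes "j \<in> {1..n}"
  shows "bform n q x (bas j) = q ^ (j - 1) * x j"
proof -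
  have "bform n q x (bas j) = (\<Sum>k\<in>{1..n}. if k = j then q ^ (j - 1) * x j else 0)"
    unfolding bform_def by (rule sum.cong) (auto simp: bas_def)
  with assms show ?thesis by simp
qed

lemma bform_nondegenerate:
  assumes "q \<noteq> 0" "x \<in> spE n" "\<And>y. y \<in> spE n \<Longrightarrow> bform n q x y = 0"
  shows "x = 0"
proof
  fix j
  show "x j = 0 j"
    using assms(1,2) assms(3)[OF bas_in_spE, of j] bform_bas[of j n q x] by (auto simp: spE_eq)
qed

definition reflection :: "nat \<Rightarrow> complex \<Rightarrow> cvec \<Rightarrow> cvec \<Rightarrow> cvec" where
  "reflection n q w = (\<lambda>x\<in>spE n. x - (2 * bform n q x w / bform n q w w) *\<^sub>c w)"

lemma reflection_apply:
  "x \<in> spE n \<Longrightarrow> reflection n q w x = x - (2 * bform n q x w / bform n q w w) *\<^sub>c w"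
  by (simp add: reflection_def)

lemma reflection_in_spE:
  assumes "w \<in> spE n" "x \<in> spE n"
  shows "reflection n q w x \<in> spE n"
  using assms by (auto simp: reflection_apply spE_eq cscale_def)

lemma reflection_lin_ops:
  assumes "w \<in> spE n"
  shows "reflection n q w \<in> lin_ops (spE n)"
proof -
  have "reflection n q w \<in> spE n \<rightarrow>\<^sub>E spE n"
    using reflection_in_spE[OF assms] by (auto simp del: One_nat_def) (simp add: reflection_def)
  moreover have "reflection n q w (x + y) = reflection n q w x + reflection n q w y"
    if "x \<in> spE n" "y \<in> spE n" for x y
    using that cvec.subspace_add[OF subspace_spE that]
    by (auto simp: reflection_apply bform_simps cscale_apply fun_eq_iff add_divide_distrib algebra_simps)
  moreover have "reflection n q w (c *\<^sub>c x) = c *\<^sub>c reflection n q w x" if "x \<in> spE n" for c x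
    using that cvec.subspace_scale[OF subspace_spE that]
    by (auto simp: reflection_apply bform_simps cscale_apply fun_eq_iff algebra_simps)
  ultimately show ?thesis by (auto simp: lin_ops_def)
qed

lemma reflection_scale: "c \<noteq> 0 \<Longrightarrow> reflection n q (c *\<^sub>c w) = reflection n q w"
  by (rule ext) (simp add: reflection_def bform_simps fun_eq_iff cscale_apply)

lemma bform_reflection_adjoint:
  assumes "x \<in> spE n" "y \<in> spE n"
  shows "bform n q (reflection n q w x) y = bform n q x (reflection n q w y)"
  using assms bform_commute[of n q y w] by (simp add: reflection_apply bform_simps)

lemma reflection_involution:
  assumes "w \<in> spE n" "bform n q w w \<noteq> 0" "x \<in> spE n"
  shows "reflection n q w (reflection n q w x) = x"
proof -
  have "bform n q (reflection n q w x) w = - bform n q x w"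
    unfolding reflection_apply[OF assms(3)] bform_simps using assms(2) by simp
  with reflection_apply[OF reflection_in_spE[OF assms(1,3)], of q w] reflection_apply[OF assms(3), of q w]
  show ?thesis
    by (simp add: fun_eq_iff cscale_apply)
qed

lemma bform_reflection:
  assumes "w \<in> spE n" "bform n q w w \<noteq> 0" "x \<in> spE n" "y \<in> spE n"
  shows "bform n q (reflection n q w x) (reflection n q w y) = bform n q x y"
  using assms by (simp add: bform_reflection_adjoint reflection_in_spE reflection_involution)

lemma reflection_conjugate:
  assumes a: "a \<in> spE n" "bform n q a a \<noteq> 0" and b: "b \<in> spE n"
  shows "reflection n q (reflection n q a b) =
    compose (spE n) (reflection n q a) (compose (spE n) (reflection n q b) (reflection n q a))"
proof
  fix x
  let ?a = "reflection n q a" and ?b = "reflection n q b"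
  show "reflection n q (?a b) x = compose (spE n) ?a (compose (spE n) ?b ?a) x"
  proof (cases "x \<in> spE n")
    case True
    define c where "c = - (2 * bform n q (?a x) b / bform n q b b)"
    note in_E = reflection_in_spE[OF a(1) True, of q] reflection_in_spE[OF a(1) b, of q]
    have "?b (?a x) = ?a x + c *\<^sub>c b"
      using in_E by (simp add: reflection_apply[of "?a x"] c_def)
    then have "?a (?b (?a x)) = ?a (?a x + c *\<^sub>c b)"
      by (rule arg_cong)
    also have "\<dots> = ?a (?a x) + ?a (c *\<^sub>c b)"
      by (rule lin_opsD(2)[OF reflection_lin_ops[OF a(1)] in_E(1) cvec.subspace_scale[OF subspace_spE b]])
    also have "\<dots> = x + c *\<^sub>c ?a b"
      unfolding lin_opsD(3)[OF reflection_lin_ops[OF a(1)] b] reflection_involution[OF a True] ..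
    also have "\<dots> = reflection n q (?a b) x"
      unfolding reflection_apply[OF True] bform_reflection[OF a b b]
        bform_reflection_adjoint[OF True b, of q a, symmetric] c_def by simp
    finally show ?thesis using True by (simp add: compose_def)
  qed (simp add: reflection_def compose_def)
qed

section \<open>Mirrors of a semigroup of operators\<close>

text \<open>The angle between the lines of \<open>u\<close> and \<open>v\<close> is not a rational multiple of \<open>\<pi>\<close>, expressed through
  its squared cosine without dividing by norms. The cases \<open>j = 0\<close> and \<open>j/m = 1/2\<close> rule out a
  degenerate plane and orthogonal vectors.\<close>

definition incommensurable :: "nat \<Rightarrow> complex \<Rightarrow> cvec \<Rightarrow> cvec \<Rightarrow> bool" where
  "incommensurable n q u v \<longleftrightarrow> (\<forall>(j::int) (m::nat). m \<ge> 1 \<longrightarrow>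
     (bform n q u v)\<^sup>2 \<noteq> of_real ((cos (of_int j * pi / of_nat m))\<^sup>2) * bform n q u u * bform n q v v)"

locale op_semigroup =
  fixes n :: nat and q :: complex and X :: "(cvec \<Rightarrow> cvec) set"
  assumes lin_ops_X: "X \<subseteq> lin_ops (spE n)"
    and compose_X: "\<And>S T. S \<in> X \<Longrightarrow> T \<in> X \<Longrightarrow> compose (spE n) S T \<in> X"
begin

abbreviation "E \<equiv> spE n"
abbreviation "form \<equiv> bform n q"
abbreviation "rfl \<equiv> reflection n q"
abbreviation "clX \<equiv> zariski_hull E X"

text \<open>Isotropic vectors are excluded: dividing by their norm makes \<^const>\<open>reflection\<close> the identity.\<close>

definition mirror :: "cvec \<Rightarrow> bool" where
  "mirror w \<longleftrightarrow> w \<in> E \<and> form w w \<noteq> 0 \<and> rfl w \<in> clX"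

lemma mirrorD: "mirror w \<Longrightarrow> w \<in> E" "mirror w \<Longrightarrow> form w w \<noteq> 0" "mirror w \<Longrightarrow> rfl w \<in> clX"
  by (simp_all add: mirror_def)

lemma compose_clX: "S \<in> clX \<Longrightarrow> T \<in> clX \<Longrightarrow> compose E S T \<in> clX"
  by (rule zariski_hull_compose[OF lin_ops_X compose_X])

lemma mirror_scale:
  assumes "mirror w" "c \<noteq> 0"
  shows "mirror (c *\<^sub>c w)"
  using assms cvec.subspace_scale[OF subspace_spE, of w n c]
  by (simp add: mirror_def reflection_scale bform_simps)

text \<open>The reflection in the image of \<open>b\<close> is the conjugate of the reflection in \<open>b\<close>.\<close>

lemma mirror_reflect:
  assumes "mirror a" "mirror b"
  shows "mirror (rfl a b)"
  using assms
  by (simp add: mirror_def reflection_in_spE bform_reflection reflection_conjugate compose_clX)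

lemma in_spE_line: "a \<in> E \<Longrightarrow> b \<in> E \<Longrightarrow> a + t *\<^sub>c b \<in> E"
  by (simp add: cvec.subspace_add cvec.subspace_scale subspace_spE del: plus_fun_apply)

lemma form_line:
  "form (a + t *\<^sub>c b) (a + t *\<^sub>c b) = poly [:form a a, 2 * form a b, form b b:] t"
  unfolding bform_simps by (simp add: bform_commute[of n q b a] algebra_simps)

text \<open>The entries of the reflection in \<open>w\<close> have the norm of \<open>w\<close> as their only denominator, and on the
  line \<open>w = a + t b\<close> numerators and norm are polynomials in \<open>t\<close>.\<close>

lemma poly_on_line_of_reflections:
  assumes "a \<in> E" "b \<in> E" "p \<in> poly_funs E"
  shows "\<exists>P N. \<forall>t. form (a + t *\<^sub>c b) (a + t *\<^sub>c b) \<noteq> 0 \<longrightarrow>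
    poly P t = form (a + t *\<^sub>c b) (a + t *\<^sub>c b) ^ N * p (rfl (a + t *\<^sub>c b))"
  using assms(3)
proof induction
  case (const c)
  show ?case
    by (rule exI[of _ "[:c:]"], rule exI[of _ 0]) simp
next
  case (coord v i)
  define P where "P = [:form a a, 2 * form a b, form b b:] * [:v i:]
    - smult 2 ([:form v a, form v b:] * [:a i, b i:])"
  have "poly P t = form (a + t *\<^sub>c b) (a + t *\<^sub>c b) ^ 1 * rfl (a + t *\<^sub>c b) v i"
    if "form (a + t *\<^sub>c b) (a + t *\<^sub>c b) \<noteq> 0" for t
  proof -
    let ?w = "a + t *\<^sub>c b"
    have "form ?w ?w * rfl ?w v i = form ?w ?w * v i - 2 * form v ?w * ?w i"
      using that coord by (simp add: reflection_apply cscale_apply field_simps)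
    moreover have "form v ?w = poly [:form v a, form v b:] t" "?w i = poly [:a i, b i:] t"
      by (simp_all add: bform_simps cscale_apply del: plus_fun_apply) (simp add: cscale_apply)
    ultimately show ?thesis
      by (simp add: P_def form_line algebra_simps del: plus_fun_apply)
  qed
  then show ?case by blast
next
  case (add f g)
  then obtain P N P' N' where
    P: "\<And>t. form (a + t *\<^sub>c b) (a + t *\<^sub>c b) \<noteq> 0 \<Longrightarrow>
      poly P t = form (a + t *\<^sub>c b) (a + t *\<^sub>c b) ^ N * f (rfl (a + t *\<^sub>c b))"
    "\<And>t. form (a + t *\<^sub>c b) (a + t *\<^sub>c b) \<noteq> 0 \<Longrightarrow>
      poly P' t = form (a + t *\<^sub>c b) (a + t *\<^sub>c b) ^ N' * g (rfl (a + t *\<^sub>c b))"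
    by blast
  let ?Q = "[:form a a, 2 * form a b, form b b:]"
  have "poly (P * ?Q ^ N' + P' * ?Q ^ N) t = form (a + t *\<^sub>c b) (a + t *\<^sub>c b) ^ (N + N') *
    (f (rfl (a + t *\<^sub>c b)) + g (rfl (a + t *\<^sub>c b)))"
    if "form (a + t *\<^sub>c b) (a + t *\<^sub>c b) \<noteq> 0" for t
    unfolding poly_add poly_mult poly_power form_line[symmetric] P[OF that]
    by (simp add: algebra_simps power_add del: plus_fun_apply)
  then show ?case by blast
next
  case (mult f g)
  then obtain P N P' N' where
    P: "\<And>t. form (a + t *\<^sub>c b) (a + t *\<^sub>c b) \<noteq> 0 \<Longrightarrow>
      poly P t = form (a + t *\<^sub>c b) (a + t *\<^sub>c b) ^ N * f (rfl (a + t *\<^sub>c b))"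
    "\<And>t. form (a + t *\<^sub>c b) (a + t *\<^sub>c b) \<noteq> 0 \<Longrightarrow>
      poly P' t = form (a + t *\<^sub>c b) (a + t *\<^sub>c b) ^ N' * g (rfl (a + t *\<^sub>c b))"
    by blast
  have "poly (P * P') t = form (a + t *\<^sub>c b) (a + t *\<^sub>c b) ^ (N + N') *
    (f (rfl (a + t *\<^sub>c b)) * g (rfl (a + t *\<^sub>c b)))"
    if "form (a + t *\<^sub>c b) (a + t *\<^sub>c b) \<noteq> 0" for t
    unfolding poly_mult P[OF that] by (simp add: power_add mult_ac del: plus_fun_apply)
  then show ?case by blast
qed

text \<open>A polynomial function that vanishes on \<open>X\<close> vanishes at infinitely many reflections of the line, so
  the numerator polynomial of the preceding lemma is zero.\<close>

lemma mirrors_on_line: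
  assumes "a \<in> E" "b \<in> E" and inf: "infinite {t. mirror (a + t *\<^sub>c b)}"
    and s: "form (a + s *\<^sub>c b) (a + s *\<^sub>c b) \<noteq> 0"
  shows "mirror (a + s *\<^sub>c b)"
proof -
  have "rfl (a + s *\<^sub>c b) \<in> clX"
  proof (rule zariski_hullI)
    show "rfl (a + s *\<^sub>c b) \<in> lin_ops E"
      using assms by (intro reflection_lin_ops in_spE_line)
    fix p assume p: "p \<in> poly_funs E" "\<And>S. S \<in> X \<Longrightarrow> p S = 0"
    obtain P N where P: "\<And>t. form (a + t *\<^sub>c b) (a + t *\<^sub>c b) \<noteq> 0 \<Longrightarrow>
        poly P t = form (a + t *\<^sub>c b) (a + t *\<^sub>c b) ^ N * p (rfl (a + t *\<^sub>c b))"
      using poly_on_line_of_reflections[OF assms(1,2) p(1)] by blast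
    have "poly P t = 0" if "mirror (a + t *\<^sub>c b)" for t
      using P[OF mirrorD(2)[OF that]] zariski_hullD[OF mirrorD(3)[OF that] p] by simp
    then have "{t. mirror (a + t *\<^sub>c b)} \<subseteq> {t. poly P t = 0}" by blast
    with inf have "P = 0"
      using poly_roots_finite finite_subset by blast
    then show "p (rfl (a + s *\<^sub>c b)) = 0"
      using P[OF s] s by (simp del: plus_fun_apply)
  qed
  with assms show ?thesis by (simp add: mirror_def in_spE_line del: plus_fun_apply)
qed

text \<open>Alternately reflecting \<open>u\<close> and \<open>v\<close> in each other gives, up to scalars, the sequence
  \<open>y\<^sub>m = D\<^sub>m\<^sub>+\<^sub>1 v - D\<^sub>m u\<close>, where \<open>D\<^sub>m = z\<^sup>m - z\<^sup>-\<^sup>m\<close> and \<open>z + z\<^sup>-\<^sup>1\<close> is twice the cosine \<open>c\<close> of the angle. Thus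
  \<open>D\<^sub>m / D\<^sub>1\<close> is a Chebyshev polynomial of the second kind in \<open>c\<close>. If the angle is not a rational
  multiple of \<open>\<pi>\<close>, then \<open>z\<close> is not a root of unity, no \<open>D\<^sub>m\<close> with \<open>m \<ge> 1\<close> vanishes, and the vectors
  \<open>y\<^sub>m\<close> span infinitely many distinct lines.\<close>

lemma mirrors_in_unit_plane:
  assumes u: "mirror u" "form u u = 1" and v: "mirror v" "form v v = 1"
    and irr: "incommensurable n q u v"
    and w: "form (u + s *\<^sub>c v) (u + s *\<^sub>c v) \<noteq> 0"
  shows "mirror (u + s *\<^sub>c v)"
proof -
  define c where "c = form u v"
  define z where "z = c + csqrt (c\<^sup>2 - 1)"
  define z' where "z' = c - csqrt (c\<^sup>2 - 1)"
  have zz: "z * z' = 1" "z + z' = 2 * c"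
    using power2_csqrt[of "c\<^sup>2 - 1"] by (simp_all add: z_def z'_def algebra_simps power2_eq_square)
  define D where "D m = z ^ m - z' ^ m" for m
  have zz_pow: "z ^ m * z' ^ m = 1" for m
    using zz(1) by (simp flip: power_mult_distrib)
  \<comment> \<open>if \<open>z ^ m = z' ^ m\<close>, then \<open>z\<close> is a root of unity of order dividing \<open>2 m\<close>, so that \<open>c\<close> is the
    cosine of a multiple of \<open>\<pi> / m\<close>\<close>
  have D_nz: "D m \<noteq> 0" if "m \<ge> 1" for m
  proof
    assume "D m = 0"
    then have "z ^ (2 * m) = 1"
      using zz_pow[of m] by (simp add: D_def mult_2 power_add)
    moreover have "(\<lambda>k. cis (2 * pi * real k / real (2 * m))) ` {..<2 * m} = {z. z ^ (2 * m) = 1}"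
      using that by (intro bij_betw_imp_surj_on bij_betw_roots_unity) simp
    ultimately obtain k where k: "z = cis (2 * pi * real k / real (2 * m))"
      by blast
    have "z * z' = z * cis (- (2 * pi * real k / real (2 * m)))"
      using zz(1) k by (simp add: cis_mult)
    then have "z' = cis (- (2 * pi * real k / real (2 * m)))"
      using zz(1) by (metis mult_cancel_left mult_zero_left zero_neq_one)
    then have "2 * c = 2 * of_real (cos (2 * pi * real k / real (2 * m)))"
      unfolding zz(2)[symmetric] k by (simp add: complex_eq_iff)
    moreover have "2 * pi * real k / real (2 * m) = of_int (int k) * pi / of_nat m"
      by simp
    ultimately have "c = of_real (cos (of_int (int k) * pi / of_nat m))"
      by (metis mult_cancel_left zero_neq_numeral)
    then have "(form u v)\<^sup>2 = of_real ((cos (of_int (int k) * pi / of_nat m))\<^sup>2) * form u u * form v v"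
      by (simp add: c_def u v)
    with irr that show False
      unfolding incommensurable_def by blast
  qed
  have rec: "D (Suc (Suc m)) = 2 * c * D (Suc m) - D m" for m
  proof -
    have "z * z * A - z' * z' * B = (z + z') * (z * A - z' * B) - (A - B)" for A B
      using zz(1) by algebra
    from this[of "z ^ m" "z' ^ m"] show ?thesis
      by (simp add: D_def zz(2) mult.assoc)
  qed
  have norm: "(D (Suc m))\<^sup>2 + (D m)\<^sup>2 - 2 * c * D m * D (Suc m) = (D 1)\<^sup>2" for m
  proof -
    have "(z * A - z' * B)\<^sup>2 + (A - B)\<^sup>2 - (z + z') * (A - B) * (z * A - z' * B) = (z - z')\<^sup>2"
      if "A * B = 1" for A B
      using zz(1) that by algebra
    from this[OF zz_pow[of m]] show ?thesis
      by (simp add: D_def zz(2))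
  qed
  define y where "y m = D (Suc m) *\<^sub>c v - D m *\<^sub>c u" for m
  have vu: "form v u = c" by (simp add: c_def bform_commute)
  have form_y: "form (y m) (y m) = (D 1)\<^sup>2" for m
    unfolding norm[of m, symmetric] y_def bform_simps vu c_def[symmetric] u(2) v(2)
    by (simp add: power2_eq_square algebra_simps)
  have form_y_Suc: "form (y m) (y (Suc m)) = c * (D 1)\<^sup>2" for m
    unfolding norm[of m, symmetric] y_def bform_simps vu c_def[symmetric] u(2) v(2) rec
    by (simp add: power2_eq_square algebra_simps)
  have y_step: "y (Suc (Suc m)) = (-1) *\<^sub>c rfl (y (Suc m)) (y m)" if "y m \<in> E" for m
  proof -
    have "rfl (y (Suc m)) (y m) = y m - (2 * c) *\<^sub>c y (Suc m)"
      unfolding reflection_apply[OF that] form_y form_y_Suc using D_nz[of 1] by simp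
    then show ?thesis
      by (simp add: fun_eq_iff cscale_apply y_def rec algebra_simps)
  qed
  have y: "mirror (y m) \<and> mirror (y (Suc m))" for m
  proof (induction m)
    case 0
    have R: "rfl v u = u - (2 * c) *\<^sub>c v"
      using mirrorD(1)[OF u(1)] by (simp add: reflection_apply v(2) c_def)
    have "D 0 = 0" by (simp add: D_def)
    then have Y: "y (Suc 0) = (- D 1) *\<^sub>c rfl v u" "y 0 = D 1 *\<^sub>c v"
      unfolding R by (simp_all add: fun_eq_iff cscale_apply y_def rec[of 0] algebra_simps)
    show ?case
      unfolding Y using D_nz[of 1] by (intro conjI mirror_scale mirror_reflect u(1) v(1)) auto
  next
    case (Suc m)
    then have "mirror ((-1) *\<^sub>c rfl (y (Suc m)) (y m))"
      by (intro mirror_scale mirror_reflect) auto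
    with Suc show ?case
      by (simp only: y_step[OF mirrorD(1)] simp_thms)
  qed
  \<comment> \<open>\<open>u + t m v\<close> is the point where the line of \<open>y (Suc m)\<close> meets the affine line \<open>u + \<complex> v\<close>;
    the index starts at 1 because \<open>y 0\<close> is proportional to \<open>v\<close>\<close>
  define t where "t m = - D (Suc (Suc m)) / D (Suc m)" for m
  have "mirror (u + t m *\<^sub>c v)" for m
  proof -
    have eq: "u + t m *\<^sub>c v = (- 1 / D (Suc m)) *\<^sub>c y (Suc m)"
      using D_nz[of "Suc m"] by (simp add: fun_eq_iff cscale_apply y_def t_def field_simps)
    show ?thesis
      unfolding eq using D_nz[of "Suc m"] y[of m] by (intro mirror_scale) auto
  qed
  moreover have "inj t"
  proof (rule linorder_injI)
    fix m k :: nat assume "m < k"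
    then obtain d where k: "k = Suc (m + d)" using less_iff_Suc_add by blast
    \<comment> \<open>Cassini-type identity for the sequence \<open>D\<close>\<close>
    have cross: "D (Suc m) * D (m + d) - D (Suc (m + d)) * D m = D 1 * D d" for m d
    proof -
      have "(z * A - z' * B) * (A * C - B * C') - (z * (A * C) - z' * (B * C')) * (A - B)
        = (z - z') * (C - C')" if "A * B = 1" for A B C C'
        using zz(1) that by algebra
      from this[OF zz_pow[of m]] show ?thesis
        by (simp add: D_def power_add)
    qed
    show "t m \<noteq> t k"
    proof
      assume "t m = t k"
      then have "D (Suc (Suc m)) * D (Suc m + Suc d) = D (Suc (Suc m + Suc d)) * D (Suc m)"
        using D_nz[of "Suc m"] D_nz[of "Suc k"] by (simp add: t_def k field_simps)
      with cross[of "Suc m" "Suc d"] D_nz[of 1] D_nz[of "Suc d"] show False by simp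
    qed
  qed
  ultimately have "infinite {t. mirror (u + t *\<^sub>c v)}"
    by (metis (no_types, lifting) finite_imageD finite_subset image_subsetI infinite_UNIV_nat mem_Collect_eq)
  then show ?thesis
    by (rule mirrors_on_line[OF mirrorD(1)[OF u(1)] mirrorD(1)[OF v(1)] _ w])
qed

lemma mirrors_in_plane:
  assumes u: "mirror u" and v: "mirror v" and irr: "incommensurable n q u v"
    and w: "w = a *\<^sub>c u + b *\<^sub>c v" "form w w \<noteq> 0"
  shows "mirror w"
proof -
  define r where "r = csqrt (form u u)"
  define s where "s = csqrt (form v v)"
  have r: "r * r = form u u" "r \<noteq> 0" and s: "s * s = form v v" "s \<noteq> 0"
    using power2_csqrt[of "form u u"] power2_csqrt[of "form v v"] mirrorD(2)[OF u] mirrorD(2)[OF v]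
    by (auto simp: r_def s_def power2_eq_square)
  let ?u = "(1 / r) *\<^sub>c u" and ?v = "(1 / s) *\<^sub>c v"
  have mir: "mirror ?u" "mirror ?v"
    using r s u v by (auto intro: mirror_scale)
  have unit: "form ?u ?u = 1" "form ?v ?v = 1"
    using r s by (auto simp: bform_simps r(1)[symmetric] s(1)[symmetric])
  have irr': "incommensurable n q ?u ?v"
    unfolding incommensurable_def
  proof (intro allI impI notI)
    fix j :: int and m :: nat
    let ?C = "complex_of_real ((cos (of_int j * pi / of_nat m))\<^sup>2)"
    assume m: "m \<ge> 1" and eq: "(form ?u ?v)\<^sup>2 = ?C * form ?u ?u * form ?v ?v"
    have "form u v = r * s * form ?u ?v"
      using r(2) s(2) by (simp add: bform_simps)
    then have "(form u v)\<^sup>2 = (r * s)\<^sup>2 * (form ?u ?v)\<^sup>2"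
      by (simp only: power_mult_distrib)
    also have "\<dots> = ?C * form u u * form v v"
      unfolding eq unit r(1)[symmetric] s(1)[symmetric] by (simp add: power2_eq_square)
    finally show False
      using irr m unfolding incommensurable_def by blast
  qed
  show ?thesis
  proof (cases "a = 0")
    case True
    then have "w = b *\<^sub>c v" using w(1) by simp
    with w(2) v show ?thesis
      by (auto simp: bform_simps intro: mirror_scale)
  next
    case False
    let ?x = "?u + (b * s / (a * r)) *\<^sub>c ?v"
    have w_eq: "w = (a * r) *\<^sub>c ?x"
      using False r s by (simp add: w(1) fun_eq_iff cscale_apply field_simps)
    with w(2) have "form ?x ?x \<noteq> 0"
      by (simp add: bform_scale_left bform_scale_right del: plus_fun_apply)
    then have "mirror ?x"
      by (rule mirrors_in_unit_plane[OF mir(1) unit(1) mir(2) unit(2) irr'])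
    then show ?thesis
      unfolding w_eq using False r by (intro mirror_scale) auto
  qed
qed

lemma finite_isotropic_on_line:
  assumes "form b b \<noteq> 0"
  shows "finite {t. form (a + t *\<^sub>c b) (a + t *\<^sub>c b) = 0}"
  unfolding form_line using assms by (intro poly_roots_finite) auto

text \<open>For a fixed rational angle, the condition on \<open>t\<close> is a quadratic equation. Its leading coefficient
  is nonzero because the limiting direction \<open>b\<close> does not enclose that angle with \<open>f\<close>.\<close>

lemma countable_commensurable_on_line:
  assumes "form b b \<noteq> 0" "incommensurable n q b f"
  shows "countable {t. \<not> incommensurable n q (a + t *\<^sub>c b) f}"
proof -
  let ?C = "\<lambda>(j::int) (m::nat). complex_of_real ((cos (of_int j * pi / of_nat m))\<^sup>2)"
  let ?Z = "\<lambda>j m. {t. (form (a + t *\<^sub>c b) f)\<^sup>2 =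
    ?C j m * form (a + t *\<^sub>c b) (a + t *\<^sub>c b) * form f f}"
  have "finite (?Z j m)" if "m \<ge> 1" for j m
  proof -
    define P where "P = [:form a f, form b f:]\<^sup>2 -
      smult (?C j m * form f f) [:form a a, 2 * form a b, form b b:]"
    have "coeff P 2 = (form b f)\<^sup>2 - ?C j m * form b b * form f f"
      by (simp add: P_def power2_eq_square numeral_2_eq_2)
    also have "\<dots> \<noteq> 0"
      using assms(2) that by (simp add: incommensurable_def)
    finally have "P \<noteq> 0" by auto
    moreover have "?Z j m = {t. poly P t = 0}"
      unfolding form_line
      by (auto simp: P_def bform_add_left bform_scale_left algebra_simps simp del: plus_fun_apply)
    ultimately show ?thesis
      using poly_roots_finite by simp
  qed
  then have "countable (\<Union>j. \<Union>m\<in>{1..}. ?Z j m)"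
    by (intro countable_UN) (auto intro: countable_finite)
  moreover have "{t. \<not> incommensurable n q (a + t *\<^sub>c b) f} \<subseteq> (\<Union>j. \<Union>m\<in>{1..}. ?Z j m)"
    unfolding incommensurable_def by auto
  ultimately show ?thesis
    by (rule countable_subset[rotated])
qed

text \<open>For \<open>w = u + c f\<^sub>k\<^sub>+\<^sub>1\<close> the line \<open>w + t f\<^sub>k\<close> is used: \<open>u + t f\<^sub>k\<close> is a mirror by induction as soon as it
  is anisotropic, and for all but countably many \<open>t\<close> it is incommensurable with \<open>f\<^sub>k\<^sub>+\<^sub>1\<close>, because its
  limiting direction \<open>f\<^sub>k\<close> is.\<close>

lemma mirrors_in_span_of_chain:
  assumes "\<And>i. i \<in> {1..k} \<Longrightarrow> mirror (f i)"
    and "\<And>i. i \<in> {1..<k} \<Longrightarrow> incommensurable n q (f i) (f (Suc i))"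
    and "w \<in> cvec.span (f ` {1..k})" "form w w \<noteq> 0"
  shows "mirror w"
  using assms
proof (induction k arbitrary: w)
  case 0
  then have "w = 0" by simp
  with 0(4) show ?case by (metis bform_zero_left)
next
  case (Suc k)
  let ?g = "f (Suc k)"
  have g: "mirror ?g" using Suc.prems(1) by simp
  have "f ` {1..Suc k} = insert ?g (f ` {1..k})"
    by (simp add: atLeastAtMostSuc_conv)
  with Suc.prems(3) obtain c where c: "w - c *\<^sub>c ?g \<in> cvec.span (f ` {1..k})"
    by (auto simp: cvec.span_breakdown_eq)
  define u where "u = w - c *\<^sub>c ?g"
  have w: "w = u + c *\<^sub>c ?g" by (simp add: u_def)
  show ?case
  proof (cases "k = 0")
    case True
    with c have "w = c *\<^sub>c ?g" by simp
    with Suc.prems(4) g show ?thesis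
      by (auto simp: bform_simps intro: mirror_scale)
  next
    case False
    let ?b = "f k"
    have b: "mirror ?b" "incommensurable n q ?b ?g" "?b \<in> cvec.span (f ` {1..k})"
      using False Suc.prems(1,2) by (auto intro: cvec.span_base)
    have in_E: "cvec.span (f ` {1..k}) \<subseteq> E"
      using Suc.prems(1) by (intro cvec.span_minimal subspace_spE) (auto intro!: mirrorD(1))
    have "u \<in> E"
      using c in_E by (auto simp: u_def)
    then have w_E: "w \<in> E"
      unfolding w by (rule in_spE_line[OF _ mirrorD(1)[OF g]])
    have "mirror (w + t *\<^sub>c ?b)"
      if t: "form (u + t *\<^sub>c ?b) (u + t *\<^sub>c ?b) \<noteq> 0"
        "form (w + t *\<^sub>c ?b) (w + t *\<^sub>c ?b) \<noteq> 0"
        "incommensurable n q (u + t *\<^sub>c ?b) ?g" for t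
    proof -
      have "u + t *\<^sub>c ?b \<in> cvec.span (f ` {1..k})"
        using c b(3) unfolding u_def by (intro cvec.span_add cvec.span_scale)
      then have "mirror (u + t *\<^sub>c ?b)"
        using t(1) by (rule Suc.IH[rotated 2]) (use Suc.prems(1,2) in auto)
      moreover have "w + t *\<^sub>c ?b = 1 *\<^sub>c (u + t *\<^sub>c ?b) + c *\<^sub>c ?g"
        by (simp add: w fun_eq_iff)
      ultimately show ?thesis
        using mirrors_in_plane[OF _ g t(3) _ t(2)] by blast
    qed
    then have cover: "UNIV = {t. mirror (w + t *\<^sub>c ?b)}
        \<union> {t. form (u + t *\<^sub>c ?b) (u + t *\<^sub>c ?b) = 0}
        \<union> {t. form (w + t *\<^sub>c ?b) (w + t *\<^sub>c ?b) = 0}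
        \<union> {t. \<not> incommensurable n q (u + t *\<^sub>c ?b) ?g}"
      by blast
    have "infinite {t. mirror (w + t *\<^sub>c ?b)}"
    proof
      assume "finite {t. mirror (w + t *\<^sub>c ?b)}"
      then have "countable (UNIV :: complex set)"
        unfolding cover
        by (intro countable_Un countable_commensurable_on_line mirrorD(2) b(1,2)
            countable_finite finite_isotropic_on_line)
      with uncountable_UNIV_complex show False ..
    qed
    then have "mirror (w + 0 *\<^sub>c ?b)"
      by (rule mirrors_on_line[OF w_E mirrorD(1)[OF b(1)]]) (use Suc.prems(4) in simp)
    then show ?thesis by simp
  qed
qed

end

section \<open>Orthogonal systems and the theorem of Cartan and Dieudonne\<close>

definition isometries :: "nat \<Rightarrow> complex \<Rightarrow> (cvec \<Rightarrow> cvec) set" where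
  "isometries n q = {T \<in> lin_ops (spE n).
     \<forall>x\<in>spE n. \<forall>y\<in>spE n. bform n q (T x) (T y) = bform n q x y}"

definition orthogonal_system :: "nat \<Rightarrow> complex \<Rightarrow> cvec set \<Rightarrow> bool" where
  "orthogonal_system n q A \<longleftrightarrow> finite A \<and> A \<subseteq> spE n \<and> (\<forall>a\<in>A. bform n q a a \<noteq> 0) \<and>
     (\<forall>a\<in>A. \<forall>b\<in>A. a \<noteq> b \<longrightarrow> bform n q a b = 0)"

lemma bform_orthogonal_system:
  assumes "orthogonal_system n q A" "b \<in> A"
  shows "bform n q (\<Sum>a\<in>A. c a *\<^sub>c a) b = c b * bform n q b b"
proof -
  have "(\<Sum>a\<in>A. c a * bform n q a b) = (\<Sum>a\<in>A. if a = b then c b * bform n q b b else 0)"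
    using assms by (intro sum.cong) (auto simp: orthogonal_system_def)
  with assms show ?thesis
    by (simp add: bform_sum_left orthogonal_system_def)
qed

lemma card_orthogonal_system_le:
  assumes A: "orthogonal_system n q A"
  shows "card A \<le> n"
proof -
  have "cvec.independent A"
  proof (rule cvec.independent_if_scalars_zero)
    show "finite A" using A by (simp add: orthogonal_system_def)
    fix f b assume "(\<Sum>a\<in>A. f a *\<^sub>c a) = 0" "b \<in> A"
    then have "f b * bform n q b b = 0"
      using bform_orthogonal_system[OF A, of b f] by (simp add: bform_zero_left del: zero_fun_apply)
    with A \<open>b \<in> A\<close> show "f b = 0"
      by (simp add: orthogonal_system_def)
  qed
  moreover have "A \<subseteq> cvec.span (bas ` {1..n})"
    using A by (simp add: orthogonal_system_def spE_def)
  ultimately have "card A \<le> card (bas ` {1..n})"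
    using cvec.independent_span_bound[of "bas ` {1..n}" A] by simp
  also have "\<dots> \<le> n"
    using card_image_le[of "{1..n}" bas] by simp
  finally show ?thesis .
qed

text \<open>By polarization the form vanishes on the orthogonal complement of \<open>A\<close>. The difference of \<open>y\<close> and
  its projection to the span of \<open>A\<close> is then orthogonal to the complement and to \<open>A\<close>, hence to
  everything.\<close>

lemma orthogonal_system_spans:
  assumes q: "q \<noteq> 0" and A: "orthogonal_system n q A"
    and iso: "\<And>x. x \<in> spE n \<Longrightarrow> (\<And>a. a \<in> A \<Longrightarrow> bform n q x a = 0) \<Longrightarrow> bform n q x x = 0"
    and y: "y \<in> spE n"
  shows "y = (\<Sum>a\<in>A. (bform n q y a / bform n q a a) *\<^sub>c a)"
proof -
  define pr where "pr y = (\<Sum>a\<in>A. (bform n q y a / bform n q a a) *\<^sub>c a)" for y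
  have A_E: "a \<in> spE n" "bform n q a a \<noteq> 0" if "a \<in> A" for a
    using A that by (auto simp: orthogonal_system_def)
  have pr_E: "pr y \<in> spE n" for y
    unfolding pr_def by (intro cvec.subspace_sum cvec.subspace_scale subspace_spE A_E(1))
  have pr_A: "bform n q (y - pr y) a = 0" if "a \<in> A" for y a
    using bform_orthogonal_system[OF A that, of "\<lambda>a. bform n q y a / bform n q a a"] A_E(2)[OF that]
    by (simp add: bform_diff_left pr_def)
  have diff_E: "y - pr y \<in> spE n" if "y \<in> spE n" for y
    using that pr_E by (intro cvec.subspace_diff subspace_spE)
  have perp: "bform n q x z = 0"
    if x: "x \<in> spE n" "\<And>a. a \<in> A \<Longrightarrow> bform n q x a = 0"
      and z: "z \<in> spE n" "\<And>a. a \<in> A \<Longrightarrow> bform n q z a = 0" for x z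
  proof -
    have "bform n q (x + z) (x + z) = 0"
      using x z by (intro iso cvec.subspace_add subspace_spE) (simp_all add: bform_add_left)
    then show ?thesis
      using iso[OF x] iso[OF z]
      by (simp add: bform_add_left bform_add_right bform_commute[of n q z x] del: plus_fun_apply)
  qed
  have "y - pr y = 0"
  proof (rule bform_nondegenerate[OF q diff_E[OF y]])
    fix z assume z: "z \<in> spE n"
    have "bform n q (pr z) (y - pr y) = 0"
      unfolding pr_def[of z] bform_sum_left
      by (intro sum.neutral) (simp add: bform_commute[of n q _ "y - pr y"] pr_A)
    moreover have "bform n q (z - pr z) (y - pr y) = 0"
      by (rule perp[OF diff_E[OF z] pr_A diff_E[OF y] pr_A])
    ultimately have "bform n q z (y - pr y) = 0"
      unfolding bform_diff_left by simp
    then show "bform n q (y - pr y) z = 0"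
      by (subst bform_commute)
  qed
  then show ?thesis by (simp add: pr_def)
qed

context op_semigroup
begin

text \<open>If \<open>x\<close> is anisotropic and orthogonal to the fixed system \<open>A\<close>, one of \<open>T x - x\<close> and \<open>T x + x\<close> is
  anisotropic, since their norms add up to four times the norm of \<open>x\<close>. Reflecting in the first moves
  \<open>T x\<close> back to \<open>x\<close>; reflecting in the second moves it to \<open>- x\<close>, which the reflection in \<open>x\<close> then
  corrects. All these vectors are orthogonal to \<open>A\<close>, so \<open>insert x A\<close> is fixed by the product. The
  process ends because an orthogonal system has at most \<open>n\<close> elements.\<close>

lemma isometry_in_hull:
  assumes q: "q \<noteq> 0" and id: "(\<lambda>x\<in>E. x) \<in> clX"
    and "orthogonal_system n q A"
    and "\<And>w. w \<in> E \<Longrightarrow> (\<And>a. a \<in> A \<Longrightarrow> form w a = 0) \<Longrightarrow> form w w \<noteq> 0 \<Longrightarrow> mirror w"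
    and "T \<in> isometries n q" "\<And>a. a \<in> A \<Longrightarrow> T a = a"
  shows "T \<in> clX"
  using assms(3-)
proof (induction "n - card A" arbitrary: A T rule: less_induct)
  case less
  note A = less.prems(1) and mir = less.prems(2)
  have A_E: "a \<in> E" if "a \<in> A" for a
    using A that by (auto simp: orthogonal_system_def)
  have T: "T \<in> lin_ops E" "\<And>x y. x \<in> E \<Longrightarrow> y \<in> E \<Longrightarrow> form (T x) (T y) = form x y"
    using less.prems(3) by (auto simp: isometries_def)
  show ?case
  proof (cases "\<exists>x\<in>E. (\<forall>a\<in>A. form x a = 0) \<and> form x x \<noteq> 0")
    case False
    have "T y = y" if y: "y \<in> E" for y
    proof -
      have y_eq: "y = (\<Sum>a\<in>A. (form y a / form a a) *\<^sub>c a)"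
        using False by (intro orthogonal_system_spans[OF q A _ y]) blast
      have "T y = T (\<Sum>a\<in>A. (form y a / form a a) *\<^sub>c a)"
        using y_eq by (rule arg_cong)
      also have "\<dots> = (\<Sum>a\<in>A. (form y a / form a a) *\<^sub>c T a)"
        by (rule lin_ops_sum[OF subspace_spE T(1) A_E])
      also have "\<dots> = y"
        using less.prems(4) y_eq by simp
      finally show ?thesis .
    qed
    then have "T = (\<lambda>x\<in>E. x)"
      using lin_opsD(4)[OF T(1)] by (intro extensionalityI[of _ E]) auto
    with id show ?thesis by simp
  next
    case True
    then obtain x where x: "x \<in> E" "\<And>a. a \<in> A \<Longrightarrow> form x a = 0" "form x x \<noteq> 0" by blast
    have A': "orthogonal_system n q (insert x A)"
      using A x(1,3) x(2)[THEN trans[OF bform_commute]] x(2) by (simp add: orthogonal_system_def)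
    have "x \<notin> A" using x(2,3) by blast
    then have card: "n - card (insert x A) < n - card A"
      using card_orthogonal_system_le[OF A'] A by (simp add: orthogonal_system_def)
    have step: "S \<in> clX"
      if S: "S \<in> isometries n q" "\<And>a. a \<in> A \<Longrightarrow> S a = a" "S x = x" for S
      by (rule less.hyps[OF card A']) (use mir S in auto)
    have descend: "S \<in> clX"
      if m: "mirror m" and S: "S \<in> lin_ops E" "compose E (rfl m) S \<in> clX" for m S
    proof -
      have "compose E (rfl m) (compose E (rfl m) S) = S"
        using reflection_involution[OF mirrorD(1,2)[OF m]] lin_opsD(1,4)[OF S(1)]
        by (intro extensionalityI[of _ E]) (auto simp: compose_def)
      then show ?thesis
        using compose_clX[OF mirrorD(3)[OF m] S(2)] by simp
    qed
    have reflect: "compose E (rfl m) S \<in> isometries n q \<and> (\<forall>a\<in>A. compose E (rfl m) S a = a)"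
      if m: "mirror m" "\<And>a. a \<in> A \<Longrightarrow> form m a = 0"
        and S: "S \<in> isometries n q" "\<And>a. a \<in> A \<Longrightarrow> S a = a" for m S
    proof -
      have "compose E (rfl m) S \<in> lin_ops E"
        using m(1) S(1)
        by (intro lin_ops_compose subspace_spE reflection_lin_ops) (auto simp: isometries_def mirror_def)
      moreover have "form (rfl m (S x)) (rfl m (S y)) = form x y" if "x \<in> E" "y \<in> E" for x y
        using that S(1) lin_opsD(1)[of S E] bform_reflection[OF mirrorD(1,2)[OF m(1)]]
        by (simp add: isometries_def)
      moreover have "rfl m a = a" if "a \<in> A" for a
        using A_E[OF that] m(2)[OF that] by (simp add: reflection_apply bform_commute[of n q a m])
      ultimately show ?thesis
        using S(2) A_E by (simp add: isometries_def compose_def)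
    qed
    have Tx: "T x \<in> E" "form (T x) (T x) = form x x" "\<And>a. a \<in> A \<Longrightarrow> form (T x) a = 0"
      using lin_opsD(1)[OF T(1) x(1)] T(2)[OF x(1) x(1)] T(2)[OF x(1) A_E] less.prems(4) x(2)
      by auto
    let ?d = "T x - x" and ?s = "T x + x"
    have ds: "?d \<in> E" "?s \<in> E" "\<And>a. a \<in> A \<Longrightarrow> form ?d a = 0" "\<And>a. a \<in> A \<Longrightarrow> form ?s a = 0"
      using cvec.subspace_diff[OF subspace_spE Tx(1) x(1)] cvec.subspace_add[OF subspace_spE Tx(1) x(1)]
      by (simp_all only: bform_diff_left bform_add_left Tx(3) x(2)) simp_all
    have dd: "form ?d ?d = 2 * form (T x) ?d" "form ?s ?s = 2 * form (T x) ?s"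
      using Tx(2) by (simp_all add: bform_simps bform_commute[of n q x "T x"]
          del: plus_fun_apply minus_apply)
    show ?thesis
    proof (cases "form ?d ?d = 0")
      case False
      then have d: "mirror ?d" by (intro mir ds)
      have "rfl ?d (T x) = T x - ?d"
        using False dd(1) by (simp add: reflection_apply Tx(1) del: minus_apply)
      then have "compose E (rfl ?d) T \<in> clX"
        using reflect[OF d ds(3) less.prems(3,4)] x(1)
        by (intro step) (simp_all add: compose_def)
      then show ?thesis
        by (rule descend[OF d T(1)])
    next
      case True
      then have "form ?s ?s = 4 * form x x"
        using Tx(2) dd by (simp add: bform_simps del: plus_fun_apply minus_apply)
      with x(3) have nz: "form ?s ?s \<noteq> 0" by simp
      then have s: "mirror ?s" by (intro mir ds)
      have m: "mirror x" by (intro mir x)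
      have "rfl ?s (T x) = T x - ?s"
        using nz dd(2) by (simp add: reflection_apply Tx(1) del: minus_apply plus_fun_apply)
      then have "rfl ?s (T x) = (-1) *\<^sub>c x"
        by (simp add: fun_eq_iff cscale_apply)
      moreover have "rfl x ((-1) *\<^sub>c x) = x"
        unfolding reflection_apply[OF cvec.subspace_scale[OF subspace_spE x(1)]] bform_scale_left
        using x(3) by (simp add: fun_eq_iff cscale_apply)
      ultimately have fix_x: "compose E (rfl x) (compose E (rfl ?s) T) x = x"
        using x(1) by (simp add: compose_def)
      note sT = reflect[OF s ds(4) less.prems(3,4)]
      note xsT = reflect[OF m x(2) conjunct1[OF sT] bspec[OF conjunct2[OF sT]]]
      have "compose E (rfl x) (compose E (rfl ?s) T) \<in> clX"
        by (rule step[OF conjunct1[OF xsT] bspec[OF conjunct2[OF xsT]] fix_x])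
      then have "compose E (rfl ?s) T \<in> clX"
        by (rule descend[OF m, rotated]) (use sT in \<open>simp add: isometries_def\<close>)
      then show ?thesis
        by (rule descend[OF s T(1)])
    qed
  qed
qed

end

section \<open>The reflections of the twin group\<close>

definition fvec :: "complex \<Rightarrow> nat \<Rightarrow> cvec" where
  "fvec q i = q *\<^sub>c bas i - bas (i + 1)"

lemma fvec_in_spE: "i \<in> {1..n-1} \<Longrightarrow> fvec q i \<in> spE n"
  by (auto simp: fvec_def spE_eq bas_def cscale_def)

lemma bform_fvec:
  assumes "i \<in> {1..n-1}"
  shows "bform n q x (fvec q i) = q ^ i * (x i - x (i + 1))"
proof -
  have "q * q ^ (i - 1) = q ^ i"
    using assms by (cases i) auto
  moreover have "i \<in> {1..n}" "i + 1 \<in> {1..n}"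
    using assms by auto
  ultimately show ?thesis
    by (simp add: fvec_def bform_simps bform_bas algebra_simps)
qed

lemma bform_fvec_self:
  assumes "i \<in> {1..n-1}"
  shows "bform n q (fvec q i) (fvec q i) = q ^ i * (1 + q)"
  unfolding bform_fvec[OF assms] by (simp add: fvec_def bas_def cscale_apply algebra_simps)

lemma bform_fvec_Suc:
  assumes "i \<in> {1..n-1}" "Suc i \<in> {1..n-1}"
  shows "bform n q (fvec q i) (fvec q (Suc i)) = - (q ^ Suc i)"
  unfolding bform_fvec[OF assms(2)] by (simp add: fvec_def bas_def cscale_apply)

lemma Sbar_eq_reflection:
  assumes q: "q \<noteq> 0" "q \<noteq> -1" and i: "i \<in> {1..n-1}"
  shows "Sbar n q i = reflection n q (fvec q i)"
proof (rule extensionalityI[of _ "spE n"])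
  show "Sbar n q i \<in> extensional (spE n)" "reflection n q (fvec q i) \<in> extensional (spE n)"
    by (simp_all add: Sbar_def reflection_def)
  fix x assume x: "x \<in> spE n"
  have q1: "1 + q \<noteq> 0" using q(2) by (simp add: add_eq_0_iff)
  have coeff: "2 * bform n q x (fvec q i) / bform n q (fvec q i) (fvec q i) = 2 * (x i - x (i + 1)) / (1 + q)"
    unfolding bform_fvec_self[OF i] unfolding bform_fvec[OF i] using q(1) by simp
  have "(a * (1 - q) + b * (2 * q)) / (1 + q) = a - 2 * (a - b) / (1 + q) * q"
    "(a * 2 - b * (1 - q)) / (1 + q) = b + 2 * (a - b) / (1 + q)" for a b
    using q1 by (simp add: divide_simps; simp add: algebra_simps)+
  then show "Sbar n q i x = reflection n q (fvec q i) x"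
    unfolding reflection_apply[OF x] coeff
    by (simp add: fun_eq_iff Sbar_coord[OF i x] fvec_def bas_def cscale_apply)
qed

text \<open>With \<open>\<lambda> = cos (2 \<theta>) = 2 cos\<^sup>2 \<theta> - 1\<close>, the equation \<open>q / (1 + q)\<^sup>2 = cos\<^sup>2 \<theta>\<close> is the quadratic equation
  \<open>(1 + \<lambda>) q\<^sup>2 + 2 \<lambda> q + (1 + \<lambda>) = 0\<close>, whose roots are the two values in the hypothesis \<open>roots\<close>. The
  value \<open>\<lambda> = -1\<close> would force \<open>q = 0\<close>.\<close>

lemma incommensurable_fvec:
  assumes q: "q \<noteq> 0" "q \<noteq> -1" and i: "i \<in> {1..n-1}" "Suc i \<in> {1..n-1}"
    and roots: "\<And>(lam::real) (k::int) (m::nat).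
           m \<ge> 1 \<Longrightarrow> lam = cos (2 * of_int k * pi / of_nat m) \<Longrightarrow> lam \<noteq> -1 \<Longrightarrow>
           q \<noteq> (- of_real lam + csqrt (- 1 - 2 * of_real lam)) / (1 + of_real lam) \<and>
           q \<noteq> (- of_real lam - csqrt (- 1 - 2 * of_real lam)) / (1 + of_real lam)"
  shows "incommensurable n q (fvec q i) (fvec q (Suc i))"
  unfolding incommensurable_def
proof (intro allI impI notI)
  fix j :: int and m :: nat
  assume m: "m \<ge> 1"
  define C where "C = (cos (of_int j * pi / of_nat m))\<^sup>2"
  assume "(bform n q (fvec q i) (fvec q (Suc i)))\<^sup>2 =
    of_real ((cos (of_int j * pi / of_nat m))\<^sup>2) *
    bform n q (fvec q i) (fvec q i) * bform n q (fvec q (Suc i)) (fvec q (Suc i))"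
  then have "(q ^ i * q ^ i * q) * q = (q ^ i * q ^ i * q) * (of_real C * (1 + q)\<^sup>2)"
    unfolding bform_fvec_self[OF i(1)] bform_fvec_self[OF i(2)] bform_fvec_Suc[OF i] C_def[symmetric]
    by (simp add: power2_eq_square mult_ac)
  then have qC: "q = of_real C * (1 + q)\<^sup>2"
    using q(1) by simp
  define lam where "lam = 2 * C - 1"
  have "lam = cos (2 * (of_int j * pi / of_nat m))"
    unfolding lam_def C_def by (simp only: cos_double_cos)
  then have lam_cos: "lam = cos (2 * of_int j * pi / of_nat m)" by (simp add: mult_ac)
  have nz: "lam \<noteq> -1"
  proof
    assume "lam = -1"
    then have "C = 0" by (simp add: lam_def)
    with qC q(1) show False by simp
  qed
  let ?l = "complex_of_real lam"
  have nz': "1 + ?l \<noteq> 0"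
    using nz by (metis add_eq_0_iff of_real_1 of_real_eq_iff of_real_minus)
  have "((1 + ?l) * q + ?l)\<^sup>2 = - 1 - 2 * ?l"
  proof -
    have "?l = 2 * of_real C - 1" by (simp add: lam_def)
    with qC show ?thesis by algebra
  qed
  then have "((1 + ?l) * q + ?l)\<^sup>2 = (csqrt (- 1 - 2 * ?l))\<^sup>2" by simp
  then have "(1 + ?l) * q + ?l = csqrt (- 1 - 2 * ?l) \<or> (1 + ?l) * q + ?l = - csqrt (- 1 - 2 * ?l)"
    by (simp only: power2_eq_iff)
  moreover have "q = (- ?l + r) / (1 + ?l)" if "(1 + ?l) * q + ?l = r" for r
    unfolding that[symmetric] using nz' by simp
  ultimately have "q = (- ?l + csqrt (- 1 - 2 * ?l)) / (1 + ?l) \<or> q = (- ?l - csqrt (- 1 - 2 * ?l)) / (1 + ?l)"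
    unfolding diff_conv_add_uminus by blast
  with roots[OF m lam_cos nz] show False by blast
qed

section \<open>The fixed line and its orthogonal complement\<close>

lemma ell0_apply: "ell0 n k = (if k \<in> {1..n} then 1 else 0)"
  by (simp add: ell0_def sum_cvec_apply bas_def)

lemma ell0_in_spE: "ell0 n \<in> spE n"
  by (auto simp: spE_eq ell0_apply)

lemma bform_ell0: "bform n q (ell0 n) (ell0 n) = q_int q n"
proof -
  have "bform n q (ell0 n) (ell0 n) = (\<Sum>j\<in>{1..n}. q ^ (j - 1))"
    unfolding bform_def by (rule sum.cong) (auto simp: ell0_apply)
  also have "\<dots> = (\<Sum>j<n. q ^ j)"
    by (rule sum.reindex_bij_witness[of _ Suc "\<lambda>j. j - 1"]) auto
  finally show ?thesis by (simp add: q_int_def)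
qed

lemma spF_span: "spF n q = cvec.span (fvec q ` {1..n-1})"
  by (simp add: spF_def fvec_def)

lemma bas_congruent_mod_spF:
  assumes "Suc j \<le> n"
  shows "bas (Suc j) - q ^ j *\<^sub>c bas 1 \<in> spF n q"
  using assms
proof (induction j)
  case 0
  then show ?case by (simp add: spF_def cvec.span_zero del: zero_fun_apply)
next
  case (Suc j)
  have IH: "bas (Suc j) - q ^ j *\<^sub>c bas 1 \<in> spF n q"
    using Suc.prems by (intro Suc.IH) simp
  have "fvec q (Suc j) \<in> spF n q"
    using Suc.prems unfolding spF_span by (intro cvec.span_base) auto
  moreover have "q *\<^sub>c (bas (Suc j) - q ^ j *\<^sub>c bas 1) \<in> spF n q"
    unfolding spF_def by (rule cvec.span_scale[OF IH[unfolded spF_def]])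
  ultimately have "q *\<^sub>c (bas (Suc j) - q ^ j *\<^sub>c bas 1) - fvec q (Suc j) \<in> spF n q"
    unfolding spF_def by (intro cvec.span_diff)
  moreover have "q *\<^sub>c (bas (Suc j) - q ^ j *\<^sub>c bas 1) - fvec q (Suc j) =
      bas (Suc (Suc j)) - q ^ Suc j *\<^sub>c bas 1"
    by (simp add: fvec_def fun_eq_iff cscale_apply algebra_simps)
  ultimately show ?case by (simp only:)
qed

text \<open>Modulo \<open>F\<close> every \<open>e\<^sub>j\<close> is \<open>q\<^sup>j\<^sup>-\<^sup>1 e\<^sub>1\<close>, so \<open>x\<close> is congruent to \<open>e\<^sub>1\<close> times the value of the form at \<open>x\<close> and
  \<open>\<ell>\<^sub>0\<close>.\<close>

lemma spF_eq: "spF n q = {x \<in> spE n. bform n q x (ell0 n) = 0}"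
proof (intro equalityI subsetI)
  have sub: "cvec.subspace {x \<in> spE n. bform n q x (ell0 n) = 0}"
    using cvec.subspace_0[OF subspace_spE] cvec.subspace_add[OF subspace_spE]
      cvec.subspace_scale[OF subspace_spE]
    by (intro cvec.subspaceI) (simp_all add: bform_simps del: plus_fun_apply zero_fun_apply)
  have "fvec q i \<in> {x \<in> spE n. bform n q x (ell0 n) = 0}" if "i \<in> {1..n-1}" for i
    using that by (auto simp: fvec_in_spE bform_commute[of n q "fvec q i"] bform_fvec ell0_apply)
  then have "spF n q \<subseteq> {x \<in> spE n. bform n q x (ell0 n) = 0}"
    unfolding spF_span by (intro cvec.span_minimal sub) auto
  then show "x \<in> {x \<in> spE n. bform n q x (ell0 n) = 0}" if "x \<in> spF n q" for x
    using that by blast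
next
  fix x assume "x \<in> {x \<in> spE n. bform n q x (ell0 n) = 0}"
  then have x: "x \<in> spE n" "bform n q x (ell0 n) = 0" by auto
  have "(\<Sum>j\<in>{1..n}. x j * q ^ (j - 1)) = bform n q x (ell0 n)"
    unfolding bform_def by (rule sum.cong) (auto simp: ell0_apply)
  then have zero: "(\<Sum>j\<in>{1..n}. x j * q ^ (j - 1)) = 0" using x(2) by simp
  have "x = (\<Sum>j\<in>{1..n}. x j *\<^sub>c (bas j - q ^ (j - 1) *\<^sub>c bas 1))"
  proof
    fix i
    have "x i = (\<Sum>j\<in>{1..n}. x j * bas j i)"
      using fun_cong[OF spE_expand[OF x(1)], of i] by (simp add: sum_cvec_apply cscale_apply)
    also have "\<dots> = (\<Sum>j\<in>{1..n}. x j * bas j i) - (\<Sum>j\<in>{1..n}. x j * q ^ (j - 1)) * bas 1 i"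
      unfolding zero by simp
    also have "\<dots> = (\<Sum>j\<in>{1..n}. x j *\<^sub>c (bas j - q ^ (j - 1) *\<^sub>c bas 1)) i"
      unfolding sum_distrib_right sum_subtractf[symmetric] sum_cvec_apply
      by (rule sum.cong) (simp_all add: cscale_apply algebra_simps)
    finally show "x i = (\<Sum>j\<in>{1..n}. x j *\<^sub>c (bas j - q ^ (j - 1) *\<^sub>c bas 1)) i" .
  qed
  also have "\<dots> \<in> spF n q"
    unfolding spF_def
  proof (intro cvec.span_sum cvec.span_scale)
    fix j assume "j \<in> {1..n}"
    then show "bas j - q ^ (j - 1) *\<^sub>c bas 1 \<in> cvec.span ((\<lambda>i. q *\<^sub>c bas i - bas (i + 1)) ` {1..n-1})"
      using bas_congruent_mod_spF[of "j - 1" n q] unfolding spF_def by auto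
  qed
  finally show "x \<in> spF n q" .
qed

text \<open>Restriction of operators is a polynomial map, so it carries density on \<open>E\<close> to density on \<open>F\<close>.\<close>

lemma poly_funs_restrict:
  assumes "W \<subseteq> V" "p \<in> poly_funs W"
  shows "(\<lambda>T. p (restrict T W)) \<in> poly_funs V"
  using assms(2)
proof induction
  case (coord v i)
  then show ?case using assms(1) by (simp add: poly_funs.coord subsetD)
qed (auto intro: poly_funs.intros)

lemma orth_groupD:
  assumes "T \<in> carrier (orth_group n q V)"
  shows "T \<in> lin_ops V" "T \<in> Bij V"
    "x \<in> V \<Longrightarrow> y \<in> V \<Longrightarrow> bform n q (T x) (T y) = bform n q x y"
  using assms by (auto simp: orth_group_def)

text \<open>An isometry that fixes \<open>\<ell>\<^sub>0\<close> preserves its orthogonal complement, which is \<open>F\<close>.\<close>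

lemma fixing_ell0:
  assumes T: "T \<in> carrier (orth_group n q (spE n))" and fixed: "T (ell0 n) = ell0 n"
  shows "T \<in> orth_prod n q" "\<forall>x\<in>spL n. T x = x"
proof -
  note TD = orth_groupD[OF T]
  let ?F = "spF n q"
  have sL: "cvec.subspace (spL n)" and sF: "cvec.subspace ?F"
    by (simp_all add: spL_def spF_def cvec.subspace_span)
  show on_L: "\<forall>x\<in>spL n. T x = x"
    using lin_opsD(3)[OF TD(1) ell0_in_spE] fixed
    by (auto simp: spL_def cvec.span_singleton)
  then have "restrict T (spL n) = \<one>\<^bsub>orth_group n q (spL n)\<^esub>"
    by (auto simp: fun_eq_iff orth_group_one)
  then have L: "restrict T (spL n) \<in> carrier (orth_group n q (spL n))"
    using monoid.one_closed[OF group.is_monoid[OF group_orth_group[OF sL]]] by simp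
  have F_E: "x \<in> spE n" if "x \<in> ?F" for x
    using that by (simp add: spF_eq)
  have T_ell0: "bform n q (T x) (ell0 n) = bform n q x (ell0 n)" if "x \<in> spE n" for x
    using TD(3)[OF that ell0_in_spE] by (simp add: fixed)
  have bij: "bij_betw T (spE n) (spE n)"
    using TD(2) by (simp add: Bij_def)
  have into: "T x \<in> ?F" if "x \<in> ?F" for x
    using that T_ell0 lin_opsD(1)[OF TD(1)] by (simp add: spF_eq)
  have "bij_betw (restrict T ?F) ?F ?F"
  proof (rule bij_betw_imageI)
    show "inj_on (restrict T ?F) ?F"
      using bij F_E by (auto simp: bij_betw_def inj_on_def)
    have "y \<in> T ` ?F" if y: "y \<in> ?F" for y
    proof -
      obtain x where x: "x \<in> spE n" "y = T x"
        using bij_betw_imp_surj_on[OF bij] F_E[OF y] by blast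
      with y T_ell0[OF x(1)] have "x \<in> ?F" by (simp add: spF_eq)
      with x(2) show ?thesis by blast
    qed
    then show "restrict T ?F ` ?F = ?F"
      using into by auto
  qed
  then have "restrict T ?F \<in> Bij ?F" by (simp add: Bij_def)
  moreover have "restrict T ?F \<in> lin_ops ?F"
    unfolding lin_ops_def
  proof (intro CollectI conjI ballI allI)
    show "restrict T ?F \<in> ?F \<rightarrow>\<^sub>E ?F" using into by simp
    show "restrict T ?F (x + y) = restrict T ?F x + restrict T ?F y" if "x \<in> ?F" "y \<in> ?F" for x y
      using that cvec.subspace_add[OF sF that] lin_opsD(2)[OF TD(1) F_E F_E]
      by (simp del: plus_fun_apply)
    show "restrict T ?F (c *\<^sub>c x) = c *\<^sub>c restrict T ?F x" if "x \<in> ?F" for c x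
      using that cvec.subspace_scale[OF sF that] lin_opsD(3)[OF TD(1) F_E] by simp
  qed
  ultimately have "restrict T ?F \<in> carrier (orth_group n q ?F)"
    using TD(3) F_E by (simp add: orth_group_def)
  with T L show "T \<in> orth_prod n q"
    by (simp add: orth_prod_def)
qed

section \<open>The image of the twin group\<close>

lemma Sbar_ell0:
  assumes "q \<noteq> 0" "q \<noteq> -1" "i \<in> {1..n-1}"
  shows "Sbar n q i (ell0 n) = ell0 n"
  using assms(3)
  by (simp add: Sbar_eq_reflection[OF assms] reflection_apply[OF ell0_in_spE] bform_fvec[OF assms(3)])
    (auto simp: ell0_apply)

text \<open>An element of the presented group is the class of a word, so the claim is proved letter by letter.
  For a formal inverse letter it follows from cancellation against the generator, whose reflection is
  an involution fixing \<open>\<ell>\<^sub>0\<close>.\<close>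

lemma twin_image_fixes_ell0:
  assumes q: "q \<noteq> 0" "q \<noteq> -1"
    and rho: "\<rho> \<in> hom (TW n) (orth_group n q (spE n))"
    and gen: "\<And>i. i \<in> {1..n-1} \<Longrightarrow> \<rho> (tw_gen n i) = Sbar n q i"
    and g: "g \<in> carrier (TW n)"
  shows "\<rho> g (ell0 n) = ell0 n"
proof -
  let ?I = "{1..n-1}" and ?O = "orth_group n q (spE n)"
  let ?c = "pres_class ?I (TW_rels n)" and ?W = "lists (?I \<times> (UNIV :: bool set))"
  interpret O: group ?O by (rule group_orth_group[OF subspace_spE])
  interpret TW: group "TW n" unfolding TW_def by (rule group_presented_group)
  interpret h: group_hom "TW n" ?O \<rho> using rho by unfold_locales
  have one: "?c [] = \<one>\<^bsub>TW n\<^esub>" by (simp add: TW_def presented_group_def)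
  have carr: "?c w \<in> carrier (TW n)" if "w \<in> ?W" for w
    using that by (simp add: TW_def presented_group_def)
  have append: "\<rho> (?c (v @ w)) (ell0 n) = \<rho> (?c v) (\<rho> (?c w) (ell0 n))"
    if "v \<in> ?W" "w \<in> ?W" for v w
  proof -
    have "?c (v @ w) = ?c v \<otimes>\<^bsub>TW n\<^esub> ?c w"
      using pres_mult[OF that, of "TW_rels n"] by (simp add: TW_def)
    then have "\<rho> (?c (v @ w)) = compose (spE n) (\<rho> (?c v)) (\<rho> (?c w))"
      using h.hom_mult[OF carr[OF that(1)] carr[OF that(2)]]
        orth_mult[OF orth_groupD(2)[OF h.hom_closed[OF carr[OF that(1)]]]
          orth_groupD(2)[OF h.hom_closed[OF carr[OF that(2)]]], of n q] by simp
    then show ?thesis using ell0_in_spE by (simp add: compose_def)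
  qed
  have fixed_Nil: "\<rho> (?c []) (ell0 n) = ell0 n"
    unfolding one h.hom_one orth_group_one using ell0_in_spE by simp
  have letter: "\<rho> (?c [(i, b)]) (ell0 n) = ell0 n" if i: "i \<in> ?I" for i b
  proof (cases b)
    case True
    with gen[OF i] Sbar_ell0[OF q i] show ?thesis by (simp add: tw_gen_def)
  next
    case False
    let ?x = "\<rho> (?c [(i, False)]) (ell0 n)"
    have "pres_eq ?I (TW_rels n) ([] @ [(i, True), (i, \<not> True)] @ []) ([] @ [])"
      using i by (intro pres_cancel) auto
    then have "?c ([(i, True)] @ [(i, False)]) = ?c []"
      using pres_class_eqI by fastforce
    then have "Sbar n q i ?x = ell0 n"
      using append[of "[(i, True)]" "[(i, False)]"] fixed_Nil gen[OF i] i by (simp add: tw_gen_def)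
    moreover have "?x \<in> spE n"
      using lin_opsD(1)[OF orth_groupD(1)[OF h.hom_closed[OF carr]] ell0_in_spE] i by auto
    ultimately have "?x = ell0 n"
      using Sbar_sq[OF q(2) i] Sbar_ell0[OF q i] by metis
    with False show ?thesis by simp
  qed
  have word: "\<rho> (?c w) (ell0 n) = ell0 n" if "w \<in> ?W" for w
    using that
  proof (induction w)
    case Nil
    show ?case by (rule fixed_Nil)
  next
    case (Cons l w)
    obtain i b where l: "l = (i, b)" by (cases l)
    have "\<rho> (?c ([l] @ w)) (ell0 n) = \<rho> (?c [l]) (\<rho> (?c w) (ell0 n))"
      using Cons.hyps by (intro append) auto
    also have "\<dots> = ell0 n"
      unfolding Cons.IH l using Cons.hyps(1) by (intro letter) (simp add: l)
    finally show ?case by simp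
  qed
  have "carrier (TW n) = ?c ` ?W"
    by (simp add: TW_def presented_group_def)
  with g obtain w where w: "w \<in> ?W" "g = ?c w" by blast
  show ?thesis unfolding w(2) by (rule word[OF w(1)])
qed

text \<open>\<open>T\<close> on \<open>F\<close> and the identity on \<open>L\<close>: the scalar \<open>c\<close> is the coefficient of \<open>\<ell>\<^sub>0\<close> in the decomposition
  of \<open>x\<close> along \<open>E = L \<oplus> F\<close>.\<close>

definition extend_by_id :: "nat \<Rightarrow> complex \<Rightarrow> (cvec \<Rightarrow> cvec) \<Rightarrow> cvec \<Rightarrow> cvec" where
  "extend_by_id n q T = (\<lambda>x\<in>spE n. let c = bform n q x (ell0 n) / q_int q n in
     T (x - c *\<^sub>c ell0 n) + c *\<^sub>c ell0 n)"

lemma extend_by_id: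
  assumes nq: "q_int q n \<noteq> 0" and T: "T \<in> carrier (orth_group n q (spF n q))"
  shows "extend_by_id n q T \<in> isometries n q" "extend_by_id n q T (ell0 n) = ell0 n"
    "restrict (extend_by_id n q T) (spF n q) = T"
proof -
  let ?l = "ell0 n" and ?F = "spF n q" and ?T = "extend_by_id n q T"
  note TD = orth_groupD[OF T]
  define k where "k x = bform n q x ?l / q_int q n" for x
  define pr where "pr x = x - k x *\<^sub>c ?l" for x
  have sF: "cvec.subspace ?F" by (simp add: spF_def cvec.subspace_span)
  have ext: "?T x = T (pr x) + k x *\<^sub>c ?l" if "x \<in> spE n" for x
    using that by (simp add: extend_by_id_def Let_def k_def pr_def)
  have pr_F: "pr x \<in> ?F" if "x \<in> spE n" for x
  proof -
    have "pr x \<in> spE n"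
      unfolding pr_def by (intro cvec.subspace_diff cvec.subspace_scale subspace_spE ell0_in_spE that)
    moreover have "bform n q (pr x) ?l = 0"
      using nq by (simp add: pr_def bform_diff_left bform_scale_left bform_ell0 k_def)
    ultimately show ?thesis by (simp add: spF_eq)
  qed
  have F_perp: "bform n q x ?l = 0" "bform n q ?l x = 0" "x \<in> spE n" if "x \<in> ?F" for x
    using that bform_commute[of n q ?l x] by (simp_all add: spF_eq)
  have T_F: "T x \<in> ?F" if "x \<in> ?F" for x
    by (rule lin_opsD(1)[OF TD(1) that])
  have pr_add: "pr (x + y) = pr x + pr y" and k_add: "k (x + y) = k x + k y" for x y
    by (simp_all add: pr_def k_def bform_add_left fun_eq_iff cscale_apply add_divide_distrib algebra_simps)
  have pr_scale: "pr (c *\<^sub>c x) = c *\<^sub>c pr x" and k_scale: "k (c *\<^sub>c x) = c * k x" for c x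
    by (simp_all add: pr_def k_def bform_scale_left fun_eq_iff cscale_apply algebra_simps)
  have "?T \<in> lin_ops (spE n)"
    unfolding lin_ops_def
  proof (intro CollectI conjI ballI allI)
    have "?T x \<in> spE n" if "x \<in> spE n" for x
      unfolding ext[OF that]
      by (rule cvec.subspace_add[OF subspace_spE F_perp(3)[OF T_F[OF pr_F[OF that]]]
          cvec.subspace_scale[OF subspace_spE ell0_in_spE]])
    then show "?T \<in> spE n \<rightarrow>\<^sub>E spE n"
      by (auto simp: extend_by_id_def)
    show "?T (x + y) = ?T x + ?T y" if "x \<in> spE n" "y \<in> spE n" for x y
      unfolding ext[OF that(1)] ext[OF that(2)] ext[OF cvec.subspace_add[OF subspace_spE that]]
        pr_add k_add lin_opsD(2)[OF TD(1) pr_F[OF that(1)] pr_F[OF that(2)]]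
      by (simp add: fun_eq_iff cscale_apply algebra_simps)
    show "?T (c *\<^sub>c x) = c *\<^sub>c ?T x" if "x \<in> spE n" for c x
      unfolding ext[OF that] ext[OF cvec.subspace_scale[OF subspace_spE that]]
        pr_scale k_scale lin_opsD(3)[OF TD(1) pr_F[OF that]]
      by (simp add: fun_eq_iff cscale_apply algebra_simps)
  qed
  moreover have "bform n q (?T x) (?T y) = bform n q x y" if xy: "x \<in> spE n" "y \<in> spE n" for x y
  proof -
    have x: "x = pr x + k x *\<^sub>c ?l" and y: "y = pr y + k y *\<^sub>c ?l"
      by (simp_all add: pr_def)
    have split: "bform n q (u + a *\<^sub>c ?l) (v + b *\<^sub>c ?l) = bform n q u v + a * b * q_int q n"
      if "u \<in> ?F" "v \<in> ?F" for u v a b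
      unfolding bform_simps F_perp(1)[OF that(1)] F_perp(2)[OF that(2)] bform_ell0 by simp
    have "bform n q (?T x) (?T y) = bform n q (pr x) (pr y) + k x * k y * q_int q n"
      unfolding ext[OF xy(1)] ext[OF xy(2)] split[OF T_F[OF pr_F[OF xy(1)]] T_F[OF pr_F[OF xy(2)]]]
        TD(3)[OF pr_F[OF xy(1)] pr_F[OF xy(2)]] ..
    also have "\<dots> = bform n q (pr x + k x *\<^sub>c ?l) (pr y + k y *\<^sub>c ?l)"
      by (rule split[symmetric, OF pr_F[OF xy(1)] pr_F[OF xy(2)]])
    also have "\<dots> = bform n q x y"
      unfolding x[symmetric] y[symmetric] ..
    finally show ?thesis .
  qed
  ultimately show "?T \<in> isometries n q"
    by (simp add: isometries_def)
  have T0: "T 0 = 0"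
    using lin_opsD(3)[OF TD(1) cvec.subspace_0[OF sF], of 0] by simp
  have "k ?l = 1" "pr ?l = 0"
    using nq by (simp_all add: k_def pr_def bform_ell0)
  then show "?T ?l = ?l"
    unfolding ext[OF ell0_in_spE] by (simp add: T0 del: zero_fun_apply)
  show "restrict ?T ?F = T"
  proof (rule extensionalityI[of _ ?F])
    fix x assume x: "x \<in> ?F"
    then have "k x = 0" "pr x = x"
      using F_perp(1)[OF x] by (simp_all add: k_def pr_def)
    then show "restrict ?T ?F x = T x"
      using ext[OF F_perp(3)[OF x]] x by simp
  qed (use lin_opsD(4)[OF TD(1)] in auto)
qed

theorem theorem6p1:
  fixes n :: nat and q :: complex and \<rho> :: "nat gword set \<Rightarrow> cvec \<Rightarrow> cvec"
  assumes "n \<ge> 2" and "q \<noteq> 0" and "q \<noteq> -1"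
    and "\<rho> \<in> hom (TW n) (orth_group n q (spE n))"
    and "\<And>i. i \<in> {1..n-1} \<Longrightarrow> \<rho> (tw_gen n i) = Sbar n q i"
    and "q_int q n \<noteq> 0"
    and "q_fact q (n - 2) \<noteq> 0"
    and "\<And>(lam::real) (k::int) (m::nat).
           m \<ge> 1 \<Longrightarrow> lam = cos (2 * of_int k * pi / of_nat m) \<Longrightarrow> lam \<noteq> -1 \<Longrightarrow>
           q \<noteq> (- of_real lam + csqrt (- 1 - 2 * of_real lam)) / (1 + of_real lam) \<and>
           q \<noteq> (- of_real lam - csqrt (- 1 - 2 * of_real lam)) / (1 + of_real lam)"
  shows "\<rho> ` carrier (TW n) \<subseteq> orth_prod n q \<and>
    zariski_dense (spE n) (\<rho> ` carrier (TW n))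
      {T \<in> orth_prod n q. \<forall>x\<in>spL n. T x = x} \<and>
    zariski_dense (spF n q) ((\<lambda>g. restrict (\<rho> g) (spF n q)) ` carrier (TW n))
      (carrier (orth_group n q (spF n q)))"
proof -
  note q = assms(2,3) and gen = assms(5) and nq = assms(6)
  let ?O = "orth_group n q (spE n)" and ?X = "\<rho> ` carrier (TW n)"
  let ?Y = "{T \<in> orth_prod n q. \<forall>x\<in>spL n. T x = x}"
  interpret O: group ?O by (rule group_orth_group[OF subspace_spE])
  interpret TW: group "TW n" unfolding TW_def by (rule group_presented_group)
  interpret h: group_hom "TW n" ?O \<rho> using assms(4) by unfold_locales
  have X: "?X \<subseteq> ?Y"
    using fixing_ell0[OF h.hom_closed twin_image_fixes_ell0[OF q assms(4) gen]] by blast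
  interpret op_semigroup n q ?X
  proof
    show X_lin: "?X \<subseteq> lin_ops (spE n)"
      using orth_groupD(1)[OF h.hom_closed] by auto
    fix S T assume "S \<in> ?X" "T \<in> ?X"
    then obtain g g' where g: "g \<in> carrier (TW n)" "S = \<rho> g" "g' \<in> carrier (TW n)" "T = \<rho> g'"
      by auto
    then have "compose (spE n) S T = \<rho> (g \<otimes>\<^bsub>TW n\<^esub> g')"
      using orth_mult[OF orth_groupD(2)[OF h.hom_closed[OF g(1)]] orth_groupD(2)[OF h.hom_closed[OF g(3)]], of n q]
      by simp
    with g show "compose (spE n) S T \<in> ?X" by blast
  qed
  have base: "\<rho> g \<in> clX" if "g \<in> carrier (TW n)" for g
    using that by (intro zariski_hull_base[OF lin_ops_X]) simp
  have id: "(\<lambda>x\<in>spE n. x) \<in> clX"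
    using base[OF TW.one_closed] by (simp add: orth_group_one)
  have q1: "1 + q \<noteq> 0" using q(2) by (simp add: add_eq_0_iff)
  have gens: "mirror (fvec q i)" if i: "i \<in> {1..n-1}" for i
  proof -
    have "tw_gen n i \<in> carrier (TW n)"
      using i by (auto simp: tw_gen_def TW_def presented_group_def)
    from base[OF this] show ?thesis
      unfolding gen[OF i] Sbar_eq_reflection[OF q i] mirror_def
      using fvec_in_spE[OF i] bform_fvec_self[OF i] q q1 by simp
  qed
  \<comment> \<open>\<open>F\<close> is spanned by the chain of the \<open>f\<^sub>i\<close>, and consecutive ones are incommensurable\<close>
  have mirrors: "mirror w" if w: "w \<in> spE n" "form w (ell0 n) = 0" "form w w \<noteq> 0" for w
  proof (rule mirrors_in_span_of_chain[of "n - 1" "fvec q"])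
    show "w \<in> cvec.span (fvec q ` {1..n-1})"
      using w unfolding spF_span[symmetric] spF_eq by simp
    show "incommensurable n q (fvec q i) (fvec q (Suc i))" if "i \<in> {1..<n-1}" for i
      by (rule incommensurable_fvec[OF q _ _ assms(8)]) (use that in auto)
  qed (fact gens w(3))+
  have hull: "T \<in> clX" if T: "T \<in> isometries n q" "T (ell0 n) = ell0 n" for T
  proof (rule isometry_in_hull[OF q(1) id, of "{ell0 n}"])
    show "orthogonal_system n q {ell0 n}"
      using nq by (simp add: orthogonal_system_def ell0_in_spE bform_ell0)
    show "mirror w" if "w \<in> spE n" "\<And>a. a \<in> {ell0 n} \<Longrightarrow> form w a = 0" "form w w \<noteq> 0" for w
      using that by (intro mirrors) simp_all
  qed (use T in simp_all)
  have "?Y \<subseteq> clX"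
  proof
    fix T assume "T \<in> ?Y"
    then have T: "T \<in> carrier ?O" "\<forall>x\<in>spL n. T x = x"
      by (auto simp: orth_prod_def)
    have "ell0 n \<in> spL n" by (simp add: spL_def cvec.span_base)
    with T(2) orth_groupD[OF T(1)] show "T \<in> clX"
      by (intro hull) (auto simp: isometries_def)
  qed
  then have dense_E: "zariski_dense (spE n) ?X ?Y"
    by (rule zariski_denseI[OF X])
  have "zariski_dense (spF n q) ((\<lambda>g. restrict (\<rho> g) (spF n q)) ` carrier (TW n))
      (carrier (orth_group n q (spF n q)))"
  proof (rule zariski_denseI)
    show "(\<lambda>g. restrict (\<rho> g) (spF n q)) ` carrier (TW n) \<subseteq> carrier (orth_group n q (spF n q))"
      using X unfolding orth_prod_def by blast
    have "T \<in> zariski_hull (spF n q) ((\<lambda>g. restrict (\<rho> g) (spF n q)) ` carrier (TW n))"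
      if T: "T \<in> carrier (orth_group n q (spF n q))" for T
    proof (rule zariski_hullI)
      show "T \<in> lin_ops (spF n q)" by (rule orth_groupD(1)[OF T])
      fix p assume p: "p \<in> poly_funs (spF n q)"
        "\<And>S. S \<in> (\<lambda>g. restrict (\<rho> g) (spF n q)) ` carrier (TW n) \<Longrightarrow> p S = 0"
      have "spF n q \<subseteq> spE n" by (auto simp: spF_eq)
      note restr = poly_funs_restrict[OF this p(1)]
      have "p (restrict (extend_by_id n q T) (spF n q)) = 0"
        by (rule zariski_hullD[OF hull[OF extend_by_id(1,2)[OF nq T]] restr])
          (auto intro!: p(2) imageI)
      then show "p T = 0"
        by (simp only: extend_by_id(3)[OF nq T])
    qed
    then show "carrier (orth_group n q (spF n q)) \<subseteq>
      zariski_hull (spF n q) ((\<lambda>g. restrict (\<rho> g) (spF n q)) ` carrier (TW n))"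
      by (rule subsetI)
  qed
  moreover have "?X \<subseteq> orth_prod n q"
    using X by blast
  ultimately show ?thesis
    using dense_E by (intro conjI)
qed

end
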